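(* Let $\mathbf{X}=(X_1,\dots,X_d)$ be a random vector in $\mathbb{R}^d$ with probability density $f$, and let $\mathbf{X}^1,\mathbf{X}^2,\dots$ be i.i.d. copies of $\mathbf{X}$. Let $(h'_n)$ and $(h_n)$ be sequences of positive numbers. For each $n$, let $T_n$ be the empirically best spanning tree computed from $\mathbf{X}^1,\dots,\mathbf{X}^n$ with bin width $h'_n$, and let $f_n$ be the histogram-based tree density estimate built on $T_n$ from $\mathbf{X}^1,\dots,\mathbf{X}^n$ with bin width $h_n$ (both defined in the context). If $\mathbf{X}$ is bounded, the one-dimensional marginal densities $f_i$ and the two-dimensional marginal densities $f_{i,j}$ ($i\neq j$) satisfy the Lipschitz condition, and $n{h'_n}^2\to\infty$, then for every $\gamma>0$, $$\mathbb{E}\left\{\int_{\mathbb{R}^d}|f_n(\mathbf{x})-f_{T_n}(\mathbf{x})|\,d\mathbf{x}\right\}=O\left(\frac{1}{\sqrt{nh_n^2}}\right)+O(h_n)+O\left({h'_n}^{\gamma}\right)+O\left(\frac{1}{n{h'_n}^2}\right).$$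
   Context: The constants in the $O$-terms may depend on the distribution of $\mathbf{X}$ (including $d$) and on $\gamma$, but not on $n$. A function $g:\mathbb{R}^k\to\mathbb{R}$ satisfies the Lipschitz condition if there is $L$ with $|g(\mathbf{x})-g(\mathbf{x}')|\le L\|\mathbf{x}-\mathbf{x}'\|$ for all $\mathbf{x},\mathbf{x}'\in\mathbb{R}^k$ (Euclidean norm). $\mathbf{X}$ is bounded if it lies almost surely in a fixed bounded set. Let $V=\{1,\dots,d\}$, let $f_i$ and $f_{i,j}$ ($i\ne j$) be the one- and two-dimensional marginal densities of $f$, and let $\mathcal{T}$ be the finite set of all spanning trees on the vertex set $V$. Tree density: for $T\in\mathcal{T}$, $$f_T(\mathbf{x})=\prod_{(i,j)\in T}\frac{f_{i,j}(x_i,x_j)}{f_i(x_i)f_j(x_j)}\prod_{i=1}^d f_i(x_i),$$ the products over $(i,j)\in T$ being over the edges of $T$; equivalently, for any choice of root $k\in V$, with $j(i)$ the parent of $i\ne k$ in $T$, $f_T(\mathbf{x})=f_k(x_k)\prod_{i\ne k} f_{i,j(i)}(x_i,x_{j(i)})/f_{j(i)}(x_{j(i)})$ (with $0/0=0$). Uniform partition of $\mathbb{R}$ with bin width $h>0$: a partition of $\mathbb{R}$ into consecutive half-open intervals of length $h$ (the position of the grid is a fixed deterministic choice). Empirical measures: $\mu_{n,i,j}(A\times B)=\frac1n\sum_{k=1}^n\mathbb{I}_{\{X_i^{(k)}\in A,\,X_j^{(k)}\in B\}}$ and $\mu_{n,i}(A)=\frac1n\sum_{k=1}^n\mathbb{I}_{\{X_i^{(k)}\in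 A\}}$, where $X_i^{(k)}$ is the $i$-th coordinate of $\mathbf{X}^k$. Mutual information estimate: with $\mathcal{P}'_n$ the uniform partition of bin width $h'_n$, $$I_n(X_i,X_j)=\sum_{A,B\in\mathcal{P}'_n}\mu_{n,i,j}(A\times B)\log\frac{\mu_{n,i,j}(A\times B)}{\mu_{n,i}(A)\mu_{n,j}(B)}$$ (terms with $\mu_{n,i,j}(A\times B)=0$ are $0$). Empirically best tree: $T_n\in\arg\max_{T\in\mathcal{T}}\sum_{(i,j)\in T}I_n(X_i,X_j)$ (any maximizer, chosen as a function of the data). Tree density estimate: let $\mathcal{P}_n$ be the uniform partition of bin width $h_n$. Root $T_n$ at a vertex $k$ and let $j(i)$ be the parent of $i\neq k$ in $T_n$. For $x_i\in A\in\mathcal{P}_n$ and $x_{j(i)}\in B\in\mathcal{P}_n$ put $f_{n,i|j(i)}(x_i\mid x_{j(i)})=\frac{\mu_{n,i,j(i)}(A\times B)}{h_n\,\mu_{n,j(i)}(B)}$ with $0/0=0$, and for $x_k\in A\in\mathcal{P}_n$ put $f_{n,k}(x_k)=\mu_{n,k}(A)/h_n$. Then $f_n(\mathbf{x})=f_{n,k}(x_k)\prod_{i\neq k}f_{n,i|j(i)}(x_i\mid x_{j(i)})$ (the result does not depend on the choice of root). *)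

theory Defs
  imports "HOL-Probability.Probability"
begin

text \<open>
  The vertex set \<open>V = {1, ..., d}\<close> is a finite, linearly ordered type \<open>'d\<close>, and an undirected
  graph on \<open>V\<close> is a set of pairs \<open>(i, j)\<close> with \<open>i < j\<close>, one for each edge \<open>{i, j}\<close>.
\<close>

definition adjacent :: "('v \<times> 'v) set \<Rightarrow> 'v \<Rightarrow> 'v \<Rightarrow> bool" where
  "adjacent T i j \<longleftrightarrow> (i, j) \<in> T \<or> (j, i) \<in> T"

definition vertex_path :: "('v \<times> 'v) set \<Rightarrow> 'v list \<Rightarrow> bool" where
  "vertex_path T p \<longleftrightarrow> p \<noteq> [] \<and> distinct p \<and> successively (adjacent T) p"

definition connected_graph :: "('v \<times> 'v) set \<Rightarrow> bool" where
  "connected_graph T \<longleftrightarrow> (\<forall>i j. \<exists>p. vertex_path T p \<and> hd p = i \<and> last p = j)"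

definition acyclic_graph :: "('v \<times> 'v) set \<Rightarrow> bool" where
  "acyclic_graph T \<longleftrightarrow> \<not> (\<exists>p. length p \<ge> 3 \<and> vertex_path T p \<and> adjacent T (last p) (hd p))"

definition spanning_trees :: "('v::{finite,linorder} \<times> 'v) set set" where
  "spanning_trees = {T. (\<forall>(i, j)\<in>T. i < j) \<and> connected_graph T \<and> acyclic_graph T}"

text \<open>The neighbour of \<open>i \<noteq> k\<close> on the path from \<open>i\<close> to the root \<open>k\<close>.\<close>

definition parent :: "('v \<times> 'v) set \<Rightarrow> 'v \<Rightarrow> 'v \<Rightarrow> 'v" where
  "parent T k i = (THE j. \<exists>p. vertex_path T (i # j # p) \<and> last (i # j # p) = k)"

text \<open>
  \<open>f1 i\<close> and \<open>f2 i j\<close> are the marginal densities. If some \<open>f1 i (x $ i)\<close> vanishes, then so does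
  the second product; this agrees with the convention \<open>0/0 = 0\<close>.
\<close>

definition tree_density ::
    "('d::{finite,linorder} \<Rightarrow> real \<Rightarrow> real) \<Rightarrow> ('d \<Rightarrow> 'd \<Rightarrow> real \<times> real \<Rightarrow> real) \<Rightarrow>
     ('d \<times> 'd) set \<Rightarrow> real ^ 'd::_ \<Rightarrow> real" where
  "tree_density f1 f2 T x =
     (\<Prod>(i, j)\<in>T. f2 i j (x $ i, x $ j) / (f1 i (x $ i) * f1 j (x $ j))) *
     (\<Prod>i\<in>UNIV. f1 i (x $ i))"

definition uniform_partition :: "real \<Rightarrow> real set set \<Rightarrow> bool" where
  "uniform_partition h P \<longleftrightarrow>
     h > 0 \<and> (\<exists>a. P = range (\<lambda>m::int. {a + of_int m * h ..< a + (of_int m + 1) * h}))"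

definition cell :: "real set set \<Rightarrow> real \<Rightarrow> real set" where
  "cell P t = (THE A. A \<in> P \<and> t \<in> A)"

text \<open>A sample of size \<open>n\<close> is a list \<open>xs\<close> of length \<open>n\<close>.\<close>

definition emp1 :: "(real ^ 'd) list \<Rightarrow> 'd \<Rightarrow> real set \<Rightarrow> real" where
  "emp1 xs i A = (\<Sum>x\<leftarrow>xs. of_bool (x $ i \<in> A)) / real (length xs)"

definition emp2 :: "(real ^ 'd) list \<Rightarrow> 'd \<Rightarrow> 'd \<Rightarrow> real set \<Rightarrow> real set \<Rightarrow> real" where
  "emp2 xs i j A B = (\<Sum>x\<leftarrow>xs. of_bool (x $ i \<in> A \<and> x $ j \<in> B)) / real (length xs)"

text \<open>
  Only finitely many terms of the sum are nonzero, because a term with \<open>emp2 xs i j A B = 0\<close> is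
  zero.
\<close>

definition mutual_info :: "real set set \<Rightarrow> (real ^ 'd) list \<Rightarrow> 'd \<Rightarrow> 'd \<Rightarrow> real" where
  "mutual_info P xs i j =
     (\<Sum>\<^sub>\<infinity>(A, B)\<in>P \<times> P. emp2 xs i j A B * ln (emp2 xs i j A B / (emp1 xs i A * emp1 xs j B)))"

definition best_trees ::
    "real set set \<Rightarrow> (real ^ 'd::{finite,linorder}) list \<Rightarrow> ('d \<times> 'd) set set" where
  "best_trees P xs =
     {T. is_arg_max (\<lambda>T. \<Sum>(i, j)\<in>T. mutual_info P xs i j) (\<lambda>T. T \<in> spanning_trees) T}"

definition cond_histogram ::
    "real \<Rightarrow> real set set \<Rightarrow> (real ^ 'd) list \<Rightarrow> 'd \<Rightarrow> 'd \<Rightarrow> real \<Rightarrow> real \<Rightarrow> real" where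
  "cond_histogram h P xs i j s t =
     emp2 xs i j (cell P s) (cell P t) / (h * emp1 xs j (cell P t))"

definition tree_estimate ::
    "real \<Rightarrow> real set set \<Rightarrow> (real ^ 'd::{finite,linorder}) list \<Rightarrow> ('d \<times> 'd) set \<Rightarrow> 'd \<Rightarrow>
     real ^ 'd::_ \<Rightarrow> real" where
  "tree_estimate h P xs T k x =
     emp1 xs k (cell P (x $ k)) / h *
     (\<Prod>i\<in>UNIV - {k}. cond_histogram h P xs i (parent T k i) (x $ i) (x $ parent T k i))"

end

theory Submission
  imports Defs
begin

text \<open>
  Both the estimate and the tree density are products of the form
  \<open>p\<^sub>k(x\<^sub>k) * (\<Prod>i\<noteq>k. p\<^sub>i\<^sub>j(x\<^sub>i, x\<^sub>j) / p\<^sub>j(x\<^sub>j))\<close> along the same rooted tree, where \<open>j\<close> is the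
  parent of \<open>i\<close>: once with the one- and two-dimensional histograms, once with the true marginal
  densities (\<open>tree_estimate_eq_rooted_density\<close>, \<open>tree_density_eq_rooted_density\<close>). Such a product is
  a Markov chain indexed by the tree, and it is stable in total variation: attaching the vertices
  one at a time, from the root outwards, replaces one conditional density in each step, and the
  telescoping argument of \<open>l1_dist_rooted_density\<close> shows that the \<open>L\<^sup>1\<close> distance of the two products
  is at most the \<open>L\<^sup>1\<close> distance of the root marginals plus, for each edge, the \<open>L\<^sup>1\<close> distances of the
  joint densities of its endpoints and of the marginals of the parent. Only the marginal
  consistency \<open>\<integral> p\<^sub>i\<^sub>j(s, t) ds \<le> p\<^sub>j(t)\<close> enters, and it is available for histograms and for
  continuous densities at every single point.

  Summing over all vertices and all ordered pairs of vertices gives a bound that is the same for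
  every spanning tree and every root, so it applies pathwise to the random tree
  \<open>T\<^sub>n\<close> (\<open>tree_estimate_error_le\<close>). Its expectation is a finite sum of \<open>L\<^sup>1\<close> risks of histograms of
  Lipschitz densities with bounded support. With about \<open>h\<^sup>-\<^sup>2\<close> relevant cells of area \<open>h\<^sup>2\<close>, the
  fluctuation of the cell frequencies contributes \<open>\<Sum>\<^sub>A sqrt(\<mu>(A) / n) \<le> sqrt(#cells / n)\<close>, by
  Cauchy-Schwarz, and the bias is of the order of the cell diameter (\<open>histogram_risk\<close>). For bin widths
  above \<open>1\<close> the trivial bound \<open>2\<close> on the \<open>L\<^sup>1\<close> distance of two densities is already at most \<open>2 h\<close>, which
  makes the constant uniform in \<open>h\<close> (\<open>histogram_risk_rate\<close>).
\<close>

section \<open>Rooted spanning trees\<close>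

text \<open>
  A walk becomes a simple path by cutting out its loops: when the new first vertex already occurs
  on the path, everything before that occurrence is dropped. The record that all vertices of the
  path are reachable from \<open>a\<close> later keeps the path inside a subgraph with one vertex removed.
\<close>

lemma rtranclp_imp_simple_path:
  assumes "R\<^sup>*\<^sup>* a b"
  shows "\<exists>p. p \<noteq> [] \<and> distinct p \<and> successively R p \<and> hd p = a \<and> last p = b
    \<and> (\<forall>v\<in>set p. R\<^sup>*\<^sup>* a v)"
  using assms
proof (induction rule: converse_rtranclp_induct)
  case base
  then show ?case by (intro exI[of _ "[b]"]) auto
next
  case (step a a')
  then obtain p where p: "p \<noteq> []" "distinct p" "successively R p" "hd p = a'" "last p = b"
    "\<forall>v\<in>set p. R\<^sup>*\<^sup>* a' v" by blast
  have reach: "\<forall>v\<in>set p. R\<^sup>*\<^sup>* a v"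
    using p(6) step(1) by (meson converse_rtranclp_into_rtranclp)
  show ?case
  proof (cases "a \<in> set p")
    case False
    then show ?thesis using p step(1) reach
      by (intro exI[of _ "a # p"]) (auto simp: successively_Cons)
  next
    case True
    then obtain xs ys where xs: "p = xs @ a # ys" by (meson split_list)
    then show ?thesis using p reach
      by (intro exI[of _ "a # ys"]) (auto simp: successively_append_iff)
  qed
qed

lemma successively_imp_rtranclp: "successively R (x # xs) \<Longrightarrow> R\<^sup>*\<^sup>* x (last (x # xs))"
proof (induction xs arbitrary: x)
  case (Cons y ys)
  then have "R x y" "R\<^sup>*\<^sup>* y (last (y # ys))" by auto
  then show ?case by simp
qed simp

text \<open>
  Two paths from \<open>i\<close> to \<open>k\<close> that start with different edges would close a cycle through \<open>i\<close>: both
  second vertices are connected to \<open>k\<close>, hence to each other, in the graph without \<open>i\<close>. So the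
  description in the definition of \<open>parent\<close> is satisfied by one vertex only.
\<close>

lemma path_second_vertex_unique:
  assumes ac: "acyclic_graph T"
    and p: "vertex_path T (i # j # p)" "last (i # j # p) = k"
    and p': "vertex_path T (i # j' # p')" "last (i # j' # p') = k"
  shows "j = j'"
proof (rule ccontr)
  assume neq: "j \<noteq> j'"
  \<comment> \<open>adjacency in the graph without the vertex \<open>i\<close>\<close>
  define R where "R u v \<longleftrightarrow> adjacent T u v \<and> u \<noteq> i \<and> v \<noteq> i" for u v
  have R_sym: "symp R" by (auto simp: R_def symp_def adjacent_def)
  have walk: "R\<^sup>*\<^sup>* w k" if "vertex_path T (i # w # q)" "last (i # w # q) = k" for w q
  proof -
    have "i \<notin> set (w # q)" "successively (adjacent T) (w # q)"
      using that(1) by (auto simp: vertex_path_def)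
    then have "successively R (w # q)"
      by (auto simp: R_def intro!: successively_mono[of "adjacent T" "w # q"])
    from successively_imp_rtranclp[OF this] that(2) show ?thesis by simp
  qed
  have "R\<^sup>*\<^sup>* j k" "R\<^sup>*\<^sup>* k j'"
    using walk[OF p] walk[OF p'] by (auto dest: sympD[OF symp_rtranclp[OF R_sym]])
  then have "R\<^sup>*\<^sup>* j j'" by simp
  from rtranclp_imp_simple_path[OF this] obtain q where
    q: "q \<noteq> []" "distinct q" "successively R q" "hd q = j" "last q = j'" "\<forall>v\<in>set q. R\<^sup>*\<^sup>* j v"
    by blast
  have "j \<noteq> i" using p(1) by (auto simp: vertex_path_def)
  have "i \<notin> set q"
  proof
    assume "i \<in> set q"
    then have "R\<^sup>*\<^sup>* j i" using q(6) by blast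
    then show False using \<open>j \<noteq> i\<close> by (cases rule: rtranclp.cases) (auto simp: R_def)
  qed
  obtain q' where q': "q = j # q'" "q' \<noteq> []" using q neq by (cases q) (auto split: if_splits)
  have "successively (adjacent T) q" using q(3) by (rule successively_mono) (simp_all add: R_def)
  then have "vertex_path T (i # q)"
    using q \<open>i \<notin> set q\<close> p(1) by (auto simp: vertex_path_def successively_Cons)
  moreover have "length (i # q) \<ge> 3" using q' by (cases q') auto
  moreover have "adjacent T (last (i # q)) (hd (i # q))"
    using q p'(1) by (auto simp: vertex_path_def adjacent_def)
  ultimately show False using ac unfolding acyclic_graph_def by blast
qed

lemma parent_eqI:
  assumes "acyclic_graph T" "vertex_path T (i # j # p)" "last (i # j # p) = k"
  shows "parent T k i = j"
  unfolding parent_def using path_second_vertex_unique[OF assms(1)] assms(2,3) by blast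

text \<open>
  A rank that decreases from a vertex to its parent. It makes the parent function well-founded.
\<close>

definition dist_to_root :: "('v \<times> 'v) set \<Rightarrow> 'v \<Rightarrow> 'v \<Rightarrow> nat" where
  "dist_to_root T k i = (LEAST m. \<exists>p. vertex_path T p \<and> hd p = i \<and> last p = k \<and> length p = m)"

lemma parent_properties:
  assumes T: "T \<in> spanning_trees" and ik: "i \<noteq> k"
  shows adjacent_parent: "adjacent T i (parent T k i)"
    and dist_to_root_parent: "dist_to_root T k (parent T k i) < dist_to_root T k i"
proof -
  let ?Q = "\<lambda>i m. \<exists>p. vertex_path T p \<and> hd p = i \<and> last p = k \<and> length p = m"
  have ac: "acyclic_graph T" and co: "connected_graph T" using T by (auto simp: spanning_trees_def)
  have "\<exists>m. ?Q i m" using co by (auto simp: connected_graph_def)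
  then have "?Q i (dist_to_root T k i)" unfolding dist_to_root_def by (rule LeastI_ex)
  then obtain p where p: "vertex_path T p" "hd p = i" "last p = k" "length p = dist_to_root T k i"
    by blast
  obtain j q where q: "p = i # j # q"
    using p ik by (cases p; cases "tl p") (auto simp: vertex_path_def)
  then have j: "parent T k i = j" using parent_eqI[OF ac] p by auto
  show "adjacent T i (parent T k i)" using p(1) q j by (auto simp: vertex_path_def)
  have "?Q j (length (j # q))"
    using p q by (intro exI[of _ "j # q"]) (auto simp: vertex_path_def)
  then have "dist_to_root T k j \<le> length (j # q)" unfolding dist_to_root_def by (rule Least_le)
  then show "dist_to_root T k (parent T k i) < dist_to_root T k i" using p(4) q j by simp
qed

lemma parent_neq: "T \<in> spanning_trees \<Longrightarrow> i \<noteq> k \<Longrightarrow> parent T k i \<noteq> i"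
  using dist_to_root_parent[of T i k] by auto

text \<open>
  Follow the path from \<open>j\<close> to the root. If it avoids \<open>i\<close>, the edge extends it to the path from \<open>i\<close>, so
  \<open>j\<close> is the parent of \<open>i\<close>. If it meets \<open>i\<close>, it does so immediately, because otherwise the edge would
  close a cycle; then \<open>i\<close> is the parent of \<open>j\<close>.
\<close>

lemma adjacent_imp_parent:
  assumes T: "T \<in> spanning_trees" and ij: "i < j" and adj: "adjacent T i j"
  shows "(i \<noteq> k \<and> parent T k i = j) \<or> (j \<noteq> k \<and> parent T k j = i)"
proof -
  have ac: "acyclic_graph T" and co: "connected_graph T" using T by (auto simp: spanning_trees_def)
  obtain q where q: "vertex_path T q" "hd q = j" "last q = k"
    using co by (auto simp: connected_graph_def)
  show ?thesis
  proof (cases "i \<in> set q")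
    case False
    obtain r where r: "q = j # r" using q by (cases q) (auto simp: vertex_path_def)
    have "vertex_path T (i # j # r)"
      using q(1) False adj ij r by (auto simp: vertex_path_def)
    then have "parent T k i = j" using q r by (intro parent_eqI[OF ac]) auto
    moreover have "i \<noteq> k" using False q by (auto simp: vertex_path_def)
    ultimately show ?thesis by simp
  next
    case True
    then obtain u w where "q = u @ i # w" by (meson split_list)
    then obtain r1 where r: "q = (j # r1) @ i # w" using q(2) ij by (cases u) auto
    have "r1 = []"
    proof (rule ccontr)
      assume "r1 \<noteq> []"
      then have "length (j # r1 @ [i]) \<ge> 3" by (cases r1) auto
      moreover have "vertex_path T (j # r1 @ [i])"
        using q(1) unfolding r vertex_path_def
        using successively_append_iff[of "adjacent T" "j # r1 @ [i]" w] by simp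
      moreover have "adjacent T (last (j # r1 @ [i])) (hd (j # r1 @ [i]))" using adj by simp
      ultimately show False using ac unfolding acyclic_graph_def by blast
    qed
    then have "parent T k j = i" using q r by (intro parent_eqI[OF ac]) auto
    moreover have "j \<noteq> k" using q(1,3) unfolding r by (auto simp: vertex_path_def split: if_splits)
    ultimately show ?thesis by simp
  qed
qed

text \<open>
  Each edge joins exactly one non-root vertex to its parent. This turns a product over edges into a
  product over non-root vertices.
\<close>

lemma bij_betw_edges:
  assumes T: "T \<in> spanning_trees"
  shows "bij_betw (\<lambda>i. if i < parent T k i then (i, parent T k i) else (parent T k i, i))
    (UNIV - {k}) T"
proof (rule bij_betwI')
  let ?e = "\<lambda>i. if i < parent T k i then (i, parent T k i) else (parent T k i, i)"
  fix i assume i: "i \<in> UNIV - {k}"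
  have lt: "\<And>a b. (a, b) \<in> T \<Longrightarrow> a < b" using T by (auto simp: spanning_trees_def)
  show "?e i \<in> T" using adjacent_parent[OF T, of i k] i
    by (auto simp: adjacent_def dest: lt order.asym)
  fix i' assume i': "i' \<in> UNIV - {k}"
  show "?e i = ?e i' \<longleftrightarrow> i = i'"
    using dist_to_root_parent[OF T, of i k] dist_to_root_parent[OF T, of i' k] i i'
    by (auto split: if_splits)
next
  fix e assume e: "e \<in> T"
  obtain a b where ab: "e = (a, b)" by (cases e)
  then have "a < b" "adjacent T a b" using T e by (auto simp: spanning_trees_def adjacent_def)
  from adjacent_imp_parent[OF T this, of k] show
    "\<exists>i\<in>UNIV - {k}. e = (if i < parent T k i then (i, parent T k i) else (parent T k i, i))"
  proof
    assume "a \<noteq> k \<and> parent T k a = b"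
    then show ?thesis using ab \<open>a < b\<close> by (intro bexI[of _ a]) auto
  next
    assume "b \<noteq> k \<and> parent T k b = a"
    then show ?thesis using ab \<open>a < b\<close> by (intro bexI[of _ b]) auto
  qed
qed


text \<open>
  The vertex sets that arise from the root by attaching leaves one at a time: the induction along
  which the densities below are integrated out.
\<close>

inductive grown :: "('v \<Rightarrow> 'v) \<Rightarrow> 'v \<Rightarrow> 'v set \<Rightarrow> bool" for par k where
  root: "grown par k {k}"
| leaf: "grown par k I \<Longrightarrow> v \<notin> I \<Longrightarrow> par v \<in> I \<Longrightarrow> grown par k (insert v I)"

lemma grown_finite: "grown par k I \<Longrightarrow> finite I"
  by (induction rule: grown.induct) auto

lemma grown_root: "grown par k I \<Longrightarrow> k \<in> I"
  by (induction rule: grown.induct) auto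

lemma grown_closed: "grown par k I \<Longrightarrow> i \<in> I \<Longrightarrow> i \<noteq> k \<Longrightarrow> par i \<in> I"
  by (induction rule: grown.induct) auto

text \<open>
  As long as a vertex is missing, a missing vertex of least distance to the root can be attached,
  since its parent is closer to the root and therefore already present.
\<close>

lemma grown_parent_UNIV:
  fixes T :: "('v::{finite,linorder} \<times> 'v) set"
  assumes T: "T \<in> spanning_trees"
  shows "grown (parent T k) k UNIV"
proof -
  have "\<exists>I. grown (parent T k) k I \<and> card I = m" if "1 \<le> m" "m \<le> CARD('v)" for m
    using that
  proof (induction m rule: nat_induct_at_least)
    case base
    show ?case using grown.root[of "parent T k" k] by force
  next
    case (Suc m)
    then obtain I where I: "grown (parent T k) k I" "card I = m" by auto
    have "I \<noteq> UNIV" using I Suc.prems by auto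
    then have ex: "\<exists>v. v \<notin> I" by auto
    define v where "v = arg_min (dist_to_root T k) (\<lambda>v. v \<notin> I)"
    have v: "v \<notin> I" and min: "\<And>w. w \<notin> I \<Longrightarrow> dist_to_root T k v \<le> dist_to_root T k w"
      using arg_min_nat_lemma[of "\<lambda>v. v \<notin> I"] ex unfolding v_def by blast+
    have "v \<noteq> k" using v grown_root[OF I(1)] by auto
    then have "parent T k v \<in> I" using min[of "parent T k v"] dist_to_root_parent[OF T, of v k] by force
    then have "grown (parent T k) k (insert v I)" using I v by (intro grown.leaf)
    then show ?case using I v by (intro exI[of _ "insert v I"]) simp
  qed
  from this[of "CARD('v)"] obtain I where I: "grown (parent T k) k I" "card I = CARD('v)" by auto
  then have "I = UNIV" using card_subset_eq[of "UNIV :: 'v set" I] by simp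
  then show ?thesis using I by simp
qed

section \<open>Stability of densities that factorize along a rooted tree\<close>

definition l1_dist :: "('b::euclidean_space \<Rightarrow> real) \<Rightarrow> ('b \<Rightarrow> real) \<Rightarrow> ennreal" where
  "l1_dist f g = (\<integral>\<^sup>+z. ennreal \<bar>f z - g z\<bar> \<partial>lborel)"

text \<open>
  Marginal consistency of one- and two-dimensional densities, in the weak form that each joint
  density integrates to at most the marginal one. The inequality, unlike equality, passes to limits by
  Fatou's lemma and so can be had at every point instead of almost everywhere.
\<close>

definition dominated_joints ::
    "('v \<Rightarrow> real \<Rightarrow> real) \<Rightarrow> ('v \<Rightarrow> 'v \<Rightarrow> real \<times> real \<Rightarrow> real) \<Rightarrow> bool" where
  "dominated_joints p1 p2 \<longleftrightarrow>
     (\<forall>i. p1 i \<in> borel_measurable borel \<and> (\<forall>t. 0 \<le> p1 i t)) \<and>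
     (\<forall>i j. i \<noteq> j \<longrightarrow> p2 i j \<in> borel_measurable borel \<and> (\<forall>z. 0 \<le> p2 i j z) \<and>
        (\<forall>t. (\<integral>\<^sup>+s. ennreal (p2 i j (s, t)) \<partial>lborel) \<le> ennreal (p1 j t)) \<and>
        (\<forall>s. (\<integral>\<^sup>+t. ennreal (p2 i j (s, t)) \<partial>lborel) \<le> ennreal (p1 i s)))"

lemma dominated_jointsD:
  assumes "dominated_joints p1 p2"
  shows "p1 i \<in> borel_measurable borel" "0 \<le> p1 i t"
    and "i \<noteq> j \<Longrightarrow> p2 i j \<in> borel_measurable borel" "i \<noteq> j \<Longrightarrow> 0 \<le> p2 i j z"
    and "i \<noteq> j \<Longrightarrow> (\<integral>\<^sup>+s. ennreal (p2 i j (s, t)) \<partial>lborel) \<le> ennreal (p1 j t)"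
    and "i \<noteq> j \<Longrightarrow> (\<integral>\<^sup>+t. ennreal (p2 i j (s, t)) \<partial>lborel) \<le> ennreal (p1 i s)"
  using assms unfolding dominated_joints_def by blast+

text \<open>
  The root form of a tree density, restricted to a set \<open>I\<close> of vertices that contains the root \<open>k\<close> and
  the parents of its other members.
\<close>

definition rooted_density ::
    "('v \<Rightarrow> real \<Rightarrow> real) \<Rightarrow> ('v \<Rightarrow> 'v \<Rightarrow> real \<times> real \<Rightarrow> real) \<Rightarrow> ('v \<Rightarrow> 'v) \<Rightarrow> 'v \<Rightarrow>
     'v set \<Rightarrow> ('v \<Rightarrow> real) \<Rightarrow> real" where
  "rooted_density p1 p2 par k I x =
     p1 k (x k) * (\<Prod>i\<in>I - {k}. p2 i (par i) (x i, x (par i)) / p1 (par i) (x (par i)))"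

lemma rooted_density_nonneg:
  assumes "dominated_joints p1 p2" "\<And>i. i \<noteq> k \<Longrightarrow> par i \<noteq> i"
  shows "0 \<le> rooted_density p1 p2 par k I x"
  unfolding rooted_density_def using dominated_jointsD[OF assms(1)] assms(2)
  by (intro mult_nonneg_nonneg prod_nonneg ballI divide_nonneg_nonneg) (auto, metis)

lemma rooted_density_insert:
  assumes "grown par k I" "v \<notin> I" "par v \<in> I"
  shows "rooted_density p1 p2 par k (insert v I) (x(v := y)) =
    rooted_density p1 p2 par k I x * (p2 v (par v) (y, x (par v)) / p1 (par v) (x (par v)))"
proof -
  have "k \<in> I" "finite I" by (rule grown_root[OF assms(1)], rule grown_finite[OF assms(1)])
  then have eq: "insert v I - {k} = insert v (I - {k})" using assms(2) by auto
  have "(\<Prod>i\<in>I - {k}. p2 i (par i) ((x(v := y)) i, (x(v := y)) (par i)) / p1 (par i) ((x(v := y)) (par i)))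
     = (\<Prod>i\<in>I - {k}. p2 i (par i) (x i, x (par i)) / p1 (par i) (x (par i)))"
  proof (rule prod.cong)
    fix i assume "i \<in> I - {k}"
    then have "i \<noteq> v" "par i \<noteq> v" using grown_closed[OF assms(1)] assms(2) by auto
    then show "p2 i (par i) ((x(v := y)) i, (x(v := y)) (par i)) / p1 (par i) ((x(v := y)) (par i))
       = p2 i (par i) (x i, x (par i)) / p1 (par i) (x (par i))" by simp
  qed simp
  then show ?thesis
    using assms \<open>k \<in> I\<close> \<open>finite I\<close> unfolding rooted_density_def eq by (auto simp: field_simps)
qed

lemma rooted_density_measurable:
  assumes dom: "dominated_joints p1 p2" and gr: "grown par k I"
    and neq: "\<And>i. i \<noteq> k \<Longrightarrow> par i \<noteq> i"
  shows "rooted_density p1 p2 par k I \<in> borel_measurable (Pi\<^sub>M I (\<lambda>_. lborel))"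
proof -
  have [measurable]: "p1 i \<in> borel_measurable borel" for i by (rule dominated_jointsD[OF dom])
  have comp: "(\<lambda>x. x i :: real) \<in> borel_measurable (Pi\<^sub>M I (\<lambda>_. lborel))" if "i \<in> I" for i :: 'a
    using measurable_component_singleton[OF that, of "\<lambda>_. lborel :: real measure"] by simp
  have "(\<lambda>x. p1 k (x k)) \<in> borel_measurable (Pi\<^sub>M I (\<lambda>_. lborel))"
    by (rule measurable_compose[OF comp[OF grown_root[OF gr]]]) simp
  moreover have "(\<lambda>x. p2 i (par i) (x i, x (par i)) / p1 (par i) (x (par i)))
      \<in> borel_measurable (Pi\<^sub>M I (\<lambda>_. lborel))" if "i \<in> I - {k}" for i
  proof -
    have i: "i \<in> I" "par i \<in> I" "i \<noteq> par i" using that grown_closed[OF gr] neq[of i] by auto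
    have "(\<lambda>x. p2 i (par i) (x i, x (par i))) \<in> borel_measurable (Pi\<^sub>M I (\<lambda>_. lborel))"
      by (rule measurable_compose[OF borel_measurable_Pair[OF comp[OF i(1)] comp[OF i(2)]]
            dominated_jointsD(3)[OF dom i(3)]])
    moreover have "(\<lambda>x. p1 (par i) (x (par i))) \<in> borel_measurable (Pi\<^sub>M I (\<lambda>_. lborel))"
      by (rule measurable_compose[OF comp[OF i(2)]]) simp
    ultimately show ?thesis by (rule borel_measurable_divide)
  qed
  ultimately show ?thesis unfolding rooted_density_def
    by (intro borel_measurable_times borel_measurable_prod) auto
qed

lemma conditional_density_mass_le_1:
  assumes dom: "dominated_joints p1 p2" and ij: "i \<noteq> j"
  shows "(\<integral>\<^sup>+s. ennreal (p2 i j (s, t) / p1 j t) \<partial>lborel) \<le> 1"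
proof (cases "p1 j t = 0")
  case False
  note D = dominated_jointsD[OF dom]
  have pos: "p1 j t > 0" using False D(2)[of j t] by simp
  have [measurable]: "p2 i j \<in> borel_measurable borel" using D(3)[OF ij] .
  have "(\<integral>\<^sup>+s. ennreal (p2 i j (s, t) / p1 j t) \<partial>lborel)
      = (\<integral>\<^sup>+s. ennreal (1 / p1 j t) * ennreal (p2 i j (s, t)) \<partial>lborel)"
    using pos D(4)[OF ij] by (intro nn_integral_cong) (simp add: ennreal_mult[symmetric])
  also have "\<dots> = ennreal (1 / p1 j t) * (\<integral>\<^sup>+s. ennreal (p2 i j (s, t)) \<partial>lborel)"
    by (rule nn_integral_cmult) measurable
  also have "\<dots> \<le> ennreal (1 / p1 j t) * ennreal (p1 j t)"
    by (intro mult_left_mono D(5)[OF ij]) simp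
  also have "\<dots> = 1" using pos by (simp add: ennreal_mult[symmetric])
  finally show ?thesis .
qed simp

interpretation lborel_product: product_sigma_finite "\<lambda>_. lborel :: real measure"
  by standard

text \<open>
  Under the tree-indexed product the coordinate \<open>j\<close> has marginal density at most \<open>q1 j\<close>. If the last
  attached leaf is not \<open>j\<close>, it integrates out with conditional mass at most \<open>1\<close>; if it is \<open>j\<close>, the
  induction hypothesis is applied to its parent and the conditional density recombines with the
  marginal of the parent to the joint density.
\<close>

lemma rooted_density_marginal_le:
  assumes dom: "dominated_joints q1 q2" and gr: "grown par k I"
    and neq: "\<And>i. i \<noteq> k \<Longrightarrow> par i \<noteq> i"
    and j: "j \<in> I" and \<phi>: "\<phi> \<in> borel_measurable borel"
  shows "(\<integral>\<^sup>+x. ennreal (rooted_density q1 q2 par k I x) * \<phi> (x j) \<partial>Pi\<^sub>M I (\<lambda>_. lborel))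
    \<le> (\<integral>\<^sup>+t. ennreal (q1 j t) * \<phi> t \<partial>lborel)"
  using gr j \<phi>
proof (induction arbitrary: j \<phi> rule: grown.induct)
  case root
  note [measurable] = dominated_jointsD(1)[OF dom] root(2)
  have "(\<integral>\<^sup>+x. ennreal (q1 k (x k)) * \<phi> (x k) \<partial>Pi\<^sub>M {k} (\<lambda>_. lborel))
      = (\<integral>\<^sup>+t. ennreal (q1 k t) * \<phi> t \<partial>lborel)"
    by (rule lborel_product.product_nn_integral_singleton) measurable
  then show ?case using root by (simp add: rooted_density_def)
next
  case (leaf I v)
  note D = dominated_jointsD[OF dom]
  note [measurable] = D(1) leaf.prems(2)
  let ?M = "Pi\<^sub>M I (\<lambda>_. lborel :: real measure)"
  let ?j = "par v"
  let ?b = "\<lambda>x y. q2 v ?j (y, x ?j) / q1 ?j (x ?j)"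
  let ?Q = "rooted_density q1 q2 par k I"
  have "v \<noteq> k" using grown_root[OF leaf(1)] leaf(2) by auto
  then have ij: "v \<noteq> ?j" using neq[of v] by auto
  have q2[measurable]: "q2 v ?j \<in> borel_measurable borel" using D(3)[OF ij] .
  have b0: "0 \<le> ?b x y" for x :: "'a \<Rightarrow> real" and y using D(2) D(4)[OF ij] by simp
  have Q0: "0 \<le> ?Q x" for x using rooted_density_nonneg[OF dom neq] .
  have gr': "grown par k (insert v I)" using leaf by (intro grown.leaf)
  have meas: "(\<lambda>x. ennreal (rooted_density q1 q2 par k (insert v I) x) * \<phi> (x j))
      \<in> borel_measurable (Pi\<^sub>M (insert v I) (\<lambda>_. lborel))"
  proof -
    have [measurable]: "(\<lambda>x. x j) \<in> borel_measurable (Pi\<^sub>M (insert v I) (\<lambda>_. lborel :: real measure))"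
      using measurable_component_singleton[OF leaf.prems(1), of "\<lambda>_. lborel :: real measure"] by simp
    note [measurable] = rooted_density_measurable[OF dom gr' neq]
    show ?thesis by measurable
  qed
  have "(\<integral>\<^sup>+x. ennreal (rooted_density q1 q2 par k (insert v I) x) * \<phi> (x j)
        \<partial>Pi\<^sub>M (insert v I) (\<lambda>_. lborel))
      = (\<integral>\<^sup>+x. \<integral>\<^sup>+y. ennreal (?Q x * ?b x y) * \<phi> ((x(v := y)) j) \<partial>lborel \<partial>?M)"
    by (subst lborel_product.product_nn_integral_insert[OF grown_finite[OF leaf(1)] leaf(2) meas])
      (simp only: rooted_density_insert[OF leaf(1-3)])
  also have "\<dots> = (\<integral>\<^sup>+x. ennreal (?Q x) * (\<integral>\<^sup>+y. ennreal (?b x y) * \<phi> ((x(v := y)) j) \<partial>lborel) \<partial>?M)"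
    using Q0 b0
    by (intro nn_integral_cong, subst nn_integral_cmult[symmetric])
      (auto simp: ennreal_mult mult.assoc simp del: times_divide_eq_right)
  also have "\<dots> \<le> (\<integral>\<^sup>+t. ennreal (q1 j t) * \<phi> t \<partial>lborel)"
  proof (cases "j = v")
    case False
    then have "j \<in> I" using leaf.prems by auto
    have "(\<integral>\<^sup>+x. ennreal (?Q x) * (\<integral>\<^sup>+y. ennreal (?b x y) * \<phi> ((x(v := y)) j) \<partial>lborel) \<partial>?M)
        = (\<integral>\<^sup>+x. ennreal (?Q x) * (\<phi> (x j) * (\<integral>\<^sup>+y. ennreal (?b x y) \<partial>lborel)) \<partial>?M)"
      using False by (simp add: nn_integral_multc mult.commute[of _ "\<phi> _"] nn_integral_cmult)
    also have "\<dots> \<le> (\<integral>\<^sup>+x. ennreal (?Q x) * (\<phi> (x j) * 1) \<partial>?M)"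
      by (intro nn_integral_mono mult_left_mono conditional_density_mass_le_1[OF dom ij]) auto
    also have "\<dots> \<le> (\<integral>\<^sup>+t. ennreal (q1 j t) * \<phi> t \<partial>lborel)"
      using leaf.IH[OF \<open>j \<in> I\<close> leaf.prems(2)] by simp
    finally show ?thesis .
  next
    case True
    \<comment> \<open>the induction hypothesis is used for the parent, with the test function that
      averages \<open>\<phi>\<close> over the leaf\<close>
    let ?\<psi> = "\<lambda>t. \<integral>\<^sup>+y. ennreal (q2 v ?j (y, t) / q1 ?j t) * \<phi> y \<partial>lborel"
    have "(\<integral>\<^sup>+x. ennreal (?Q x) * (\<integral>\<^sup>+y. ennreal (?b x y) * \<phi> ((x(v := y)) j) \<partial>lborel) \<partial>?M)
        = (\<integral>\<^sup>+x. ennreal (?Q x) * ?\<psi> (x ?j) \<partial>?M)"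
      using True by simp
    also have "\<dots> \<le> (\<integral>\<^sup>+t. ennreal (q1 ?j t) * ?\<psi> t \<partial>lborel)"
      by (rule leaf.IH[OF leaf(3)]) measurable
    also have "\<dots> = (\<integral>\<^sup>+t. \<integral>\<^sup>+y. ennreal (q1 ?j t) * (ennreal (q2 v ?j (y, t) / q1 ?j t) * \<phi> y)
        \<partial>lborel \<partial>lborel)"
      by (intro nn_integral_cong nn_integral_cmult[symmetric]) measurable
    also have "\<dots> \<le> (\<integral>\<^sup>+t. \<integral>\<^sup>+y. ennreal (q2 v ?j (y, t)) * \<phi> y \<partial>lborel \<partial>lborel)"
    proof (intro nn_integral_mono)
      fix t y
      have "ennreal (q1 ?j t) * ennreal (q2 v ?j (y, t) / q1 ?j t) \<le> ennreal (q2 v ?j (y, t))"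
        using D(2)[of ?j t] D(4)[OF ij, of "(y, t)"]
        by (cases "q1 ?j t = 0") (auto simp: ennreal_mult[symmetric])
      then show "ennreal (q1 ?j t) * (ennreal (q2 v ?j (y, t) / q1 ?j t) * \<phi> y)
          \<le> ennreal (q2 v ?j (y, t)) * \<phi> y"
        unfolding mult.assoc[symmetric] by (rule mult_right_mono) simp
    qed
    also have "\<dots> = (\<integral>\<^sup>+y. \<integral>\<^sup>+t. ennreal (q2 v ?j (y, t)) * \<phi> y \<partial>lborel \<partial>lborel)"
      by (rule lborel_pair.Fubini') measurable
    also have "\<dots> = (\<integral>\<^sup>+y. (\<integral>\<^sup>+t. ennreal (q2 v ?j (y, t)) \<partial>lborel) * \<phi> y \<partial>lborel)"
      by (intro nn_integral_cong nn_integral_multc) measurable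
    also have "\<dots> \<le> (\<integral>\<^sup>+y. ennreal (q1 v y) * \<phi> y \<partial>lborel)"
      by (intro nn_integral_mono mult_right_mono D(6)[OF ij]) simp
    finally show ?thesis using True by simp
  qed
  finally show ?case .
qed

text \<open>
  The distance of two conditional densities, weighted by the marginal \<open>q1 j\<close>, is controlled by joint
  and marginal distances, through
  \<open>q\<^sub>j * (p\<^sub>i\<^sub>j / p\<^sub>j - q\<^sub>i\<^sub>j / q\<^sub>j) = (p\<^sub>i\<^sub>j - q\<^sub>i\<^sub>j) + (q\<^sub>j - p\<^sub>j) * (p\<^sub>i\<^sub>j / p\<^sub>j)\<close>.
\<close>

lemma conditional_density_diff_le:
  assumes dp: "dominated_joints p1 p2" and dq: "dominated_joints q1 q2" and ij: "i \<noteq> j"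
  shows "ennreal (q1 j t) * (\<integral>\<^sup>+s. ennreal \<bar>p2 i j (s, t) / p1 j t - q2 i j (s, t) / q1 j t\<bar> \<partial>lborel)
    \<le> (\<integral>\<^sup>+s. ennreal \<bar>p2 i j (s, t) - q2 i j (s, t)\<bar> \<partial>lborel) + ennreal \<bar>p1 j t - q1 j t\<bar>"
proof -
  note P = dominated_jointsD[OF dp] and Q = dominated_jointsD[OF dq]
  have [measurable]: "p2 i j \<in> borel_measurable borel" "q2 i j \<in> borel_measurable borel"
    using P(3)[OF ij] Q(3)[OF ij] by auto
  let ?d = "\<bar>p1 j t - q1 j t\<bar>"
  \<comment> \<open>only where both marginals are positive; where \<open>p1 j t = 0\<close>, the quotient \<open>p2 i j (s, t) / p1 j t\<close>
    is \<open>0\<close> and the marginal difference alone accounts for the mass of \<open>q2 i j\<close>\<close>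
  have pw: "q1 j t * \<bar>p2 i j (s, t) / p1 j t - q2 i j (s, t) / q1 j t\<bar>
      \<le> \<bar>p2 i j (s, t) - q2 i j (s, t)\<bar> + ?d * (p2 i j (s, t) / p1 j t)"
    if q: "q1 j t > 0" and p: "p1 j t > 0" for s
  proof -
    have "q1 j t * \<bar>p2 i j (s, t) / p1 j t - q2 i j (s, t) / q1 j t\<bar>
      = \<bar>q1 j t * (p2 i j (s, t) / p1 j t - q2 i j (s, t) / q1 j t)\<bar>"
      using q by (simp add: abs_mult)
    also have "q1 j t * (p2 i j (s, t) / p1 j t - q2 i j (s, t) / q1 j t)
      = (p2 i j (s, t) - q2 i j (s, t)) + (q1 j t - p1 j t) * (p2 i j (s, t) / p1 j t)"
      using p q by (simp add: field_simps)
    also have "\<bar>\<dots>\<bar> \<le> \<bar>p2 i j (s, t) - q2 i j (s, t)\<bar> + \<bar>(q1 j t - p1 j t) * (p2 i j (s, t) / p1 j t)\<bar>"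
      by (rule abs_triangle_ineq)
    also have "\<bar>(q1 j t - p1 j t) * (p2 i j (s, t) / p1 j t)\<bar> = ?d * (p2 i j (s, t) / p1 j t)"
      using P(4)[OF ij] p by (simp add: abs_mult abs_minus_commute)
    finally show ?thesis .
  qed
  consider "q1 j t = 0" | "q1 j t > 0" "p1 j t = 0" | "q1 j t > 0" "p1 j t > 0"
    using P(2)[of j t] Q(2)[of j t] by fastforce
  then show ?thesis
  proof cases
    case 1
    then show ?thesis by simp
  next
    case 2
    have "ennreal (q1 j t) * (\<integral>\<^sup>+s. ennreal \<bar>p2 i j (s, t) / p1 j t - q2 i j (s, t) / q1 j t\<bar> \<partial>lborel)
       = ennreal (q1 j t) * (\<integral>\<^sup>+s. ennreal (q2 i j (s, t) / q1 j t) \<partial>lborel)"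
      using 2 Q(4)[OF ij] by simp
    also have "\<dots> \<le> ennreal (q1 j t) * 1"
      by (intro mult_left_mono conditional_density_mass_le_1[OF dq ij]) simp
    also have "\<dots> \<le> (\<integral>\<^sup>+s. ennreal \<bar>p2 i j (s, t) - q2 i j (s, t)\<bar> \<partial>lborel) + ennreal ?d"
      using 2 by (simp add: add_increasing)
    finally show ?thesis .
  next
    case 3
    have "ennreal (q1 j t) * (\<integral>\<^sup>+s. ennreal \<bar>p2 i j (s, t) / p1 j t - q2 i j (s, t) / q1 j t\<bar> \<partial>lborel)
       = (\<integral>\<^sup>+s. ennreal (q1 j t * \<bar>p2 i j (s, t) / p1 j t - q2 i j (s, t) / q1 j t\<bar>) \<partial>lborel)"
      using 3 by (subst nn_integral_cmult[symmetric]) (auto simp: ennreal_mult)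
    also have "\<dots> \<le> (\<integral>\<^sup>+s. ennreal \<bar>p2 i j (s, t) - q2 i j (s, t)\<bar>
        + ennreal ?d * ennreal (p2 i j (s, t) / p1 j t) \<partial>lborel)"
      using pw[OF 3] 3 P(4)[OF ij]
      by (intro nn_integral_mono)
        (simp add: ennreal_mult[symmetric] ennreal_plus[symmetric] ennreal_leI del: ennreal_plus)
    also have "\<dots> = (\<integral>\<^sup>+s. ennreal \<bar>p2 i j (s, t) - q2 i j (s, t)\<bar> \<partial>lborel)
        + ennreal ?d * (\<integral>\<^sup>+s. ennreal (p2 i j (s, t) / p1 j t) \<partial>lborel)"
      by (subst nn_integral_add) (auto simp: nn_integral_cmult)
    also have "\<dots> \<le> (\<integral>\<^sup>+s. ennreal \<bar>p2 i j (s, t) - q2 i j (s, t)\<bar> \<partial>lborel) + ennreal ?d * 1"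
      by (intro add_left_mono mult_left_mono conditional_density_mass_le_1[OF dp ij]) simp
    finally show ?thesis by simp
  qed
qed

lemma ennreal_abs_diff_mult_le:
  fixes P Q a b :: real
  assumes "0 \<le> a" "0 \<le> Q"
  shows "ennreal \<bar>P * a - Q * b\<bar>
    \<le> ennreal \<bar>P - Q\<bar> * ennreal a + ennreal Q * ennreal \<bar>a - b\<bar>"
proof -
  have "P * a - Q * b = (P - Q) * a + Q * (a - b)" by (simp add: algebra_simps)
  also have "\<bar>\<dots>\<bar> \<le> \<bar>(P - Q) * a\<bar> + \<bar>Q * (a - b)\<bar>" by (rule abs_triangle_ineq)
  also have "\<dots> = \<bar>P - Q\<bar> * a + Q * \<bar>a - b\<bar>" using assms by (simp add: abs_mult)
  finally have "ennreal \<bar>P * a - Q * b\<bar> \<le> ennreal (\<bar>P - Q\<bar> * a + Q * \<bar>a - b\<bar>)"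
    by (rule ennreal_leI)
  then show ?thesis using assms by (simp add: ennreal_mult)
qed

text \<open>
  Telescoping, one leaf \<open>v\<close> at a time: with \<open>P\<close>, \<open>Q\<close> the products on the smaller vertex set and \<open>a\<close>, \<open>b\<close>
  the conditional densities of \<open>v\<close>, one has \<open>P * a - Q * b = (P - Q) * a + Q * (a - b)\<close>. In the first
  term \<open>a\<close> integrates to at most \<open>1\<close>; in the second, \<open>Q\<close> may be replaced by its marginal at the parent
  of \<open>v\<close>, which is the weight in \<open>conditional_density_diff_le\<close>.
\<close>

lemma l1_dist_rooted_density:
  assumes dp: "dominated_joints p1 p2" and dq: "dominated_joints q1 q2" and gr: "grown par k I"
    and neq: "\<And>i. i \<noteq> k \<Longrightarrow> par i \<noteq> i"
  shows "(\<integral>\<^sup>+x. ennreal \<bar>rooted_density p1 p2 par k I x - rooted_density q1 q2 par k I x\<bar>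
      \<partial>Pi\<^sub>M I (\<lambda>_. lborel))
    \<le> l1_dist (p1 k) (q1 k) +
      (\<Sum>i\<in>I - {k}. l1_dist (p2 i (par i)) (q2 i (par i)) + l1_dist (p1 (par i)) (q1 (par i)))"
  using gr
proof (induction rule: grown.induct)
  case root
  note [measurable] = dominated_jointsD(1)[OF dp] dominated_jointsD(1)[OF dq]
  have "(\<integral>\<^sup>+x. ennreal \<bar>p1 k (x k) - q1 k (x k)\<bar> \<partial>Pi\<^sub>M {k} (\<lambda>_. lborel))
      = (\<integral>\<^sup>+t. ennreal \<bar>p1 k t - q1 k t\<bar> \<partial>lborel)"
    by (rule lborel_product.product_nn_integral_singleton) measurable
  then show ?case by (simp add: rooted_density_def l1_dist_def)
next
  case (leaf I v)
  note P = dominated_jointsD[OF dp] and Q = dominated_jointsD[OF dq]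
  let ?M = "Pi\<^sub>M I (\<lambda>_. lborel :: real measure)"
  let ?j = "par v"
  let ?a = "\<lambda>t y. p2 v ?j (y, t) / p1 ?j t" and ?b = "\<lambda>t y. q2 v ?j (y, t) / q1 ?j t"
  let ?P = "rooted_density p1 p2 par k I" and ?Q = "rooted_density q1 q2 par k I"
  have "v \<noteq> k" using grown_root[OF leaf(1)] leaf(2) by auto
  then have ij: "v \<noteq> ?j" using neq[of v] by auto
  note [measurable] = P(1) Q(1) P(3)[OF ij] Q(3)[OF ij]
    rooted_density_measurable[OF dp leaf(1) neq] rooted_density_measurable[OF dq leaf(1) neq]
  have comp: "(\<lambda>x. x ?j) \<in> borel_measurable ?M"
    using measurable_component_singleton[OF leaf(3), of "\<lambda>_. lborel :: real measure"] by simp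
  have a0: "0 \<le> ?a t y" for t y using P(2) P(4)[OF ij] by simp
  have Q0: "0 \<le> ?Q x" for x using rooted_density_nonneg[OF dq neq] .
  have gr': "grown par k (insert v I)" using leaf by (intro grown.leaf)
  have meas: "(\<lambda>x. ennreal \<bar>rooted_density p1 p2 par k (insert v I) x
      - rooted_density q1 q2 par k (insert v I) x\<bar>) \<in> borel_measurable (Pi\<^sub>M (insert v I) (\<lambda>_. lborel))"
  proof -
    note [measurable] = rooted_density_measurable[OF dp gr' neq] rooted_density_measurable[OF dq gr' neq]
    show ?thesis by measurable
  qed
  let ?\<psi> = "\<lambda>t. \<integral>\<^sup>+y. ennreal \<bar>?a t y - ?b t y\<bar> \<partial>lborel"
  have "(\<integral>\<^sup>+x. ennreal \<bar>rooted_density p1 p2 par k (insert v I) x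
      - rooted_density q1 q2 par k (insert v I) x\<bar> \<partial>Pi\<^sub>M (insert v I) (\<lambda>_. lborel))
      = (\<integral>\<^sup>+x. \<integral>\<^sup>+y. ennreal \<bar>?P x * ?a (x ?j) y - ?Q x * ?b (x ?j) y\<bar> \<partial>lborel \<partial>?M)"
    by (subst lborel_product.product_nn_integral_insert[OF grown_finite[OF leaf(1)] leaf(2) meas])
      (simp only: rooted_density_insert[OF leaf(1-3)])
  also have "\<dots> \<le> (\<integral>\<^sup>+x. \<integral>\<^sup>+y. ennreal \<bar>?P x - ?Q x\<bar> * ennreal (?a (x ?j) y)
      + ennreal (?Q x) * ennreal \<bar>?a (x ?j) y - ?b (x ?j) y\<bar> \<partial>lborel \<partial>?M)"
    by (intro nn_integral_mono ennreal_abs_diff_mult_le a0 Q0)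
  also have "\<dots> = (\<integral>\<^sup>+x. ennreal \<bar>?P x - ?Q x\<bar> * (\<integral>\<^sup>+y. ennreal (?a (x ?j) y) \<partial>lborel)
      + ennreal (?Q x) * ?\<psi> (x ?j) \<partial>?M)"
  proof (intro nn_integral_cong)
    fix x
    have "(\<integral>\<^sup>+y. ennreal \<bar>?P x - ?Q x\<bar> * ennreal (?a (x ?j) y)
        + ennreal (?Q x) * ennreal \<bar>?a (x ?j) y - ?b (x ?j) y\<bar> \<partial>lborel)
      = (\<integral>\<^sup>+y. ennreal \<bar>?P x - ?Q x\<bar> * ennreal (?a (x ?j) y) \<partial>lborel)
        + (\<integral>\<^sup>+y. ennreal (?Q x) * ennreal \<bar>?a (x ?j) y - ?b (x ?j) y\<bar> \<partial>lborel)"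
      by (rule nn_integral_add) measurable
    also have "(\<integral>\<^sup>+y. ennreal \<bar>?P x - ?Q x\<bar> * ennreal (?a (x ?j) y) \<partial>lborel)
      = ennreal \<bar>?P x - ?Q x\<bar> * (\<integral>\<^sup>+y. ennreal (?a (x ?j) y) \<partial>lborel)"
      by (rule nn_integral_cmult) measurable
    also have "(\<integral>\<^sup>+y. ennreal (?Q x) * ennreal \<bar>?a (x ?j) y - ?b (x ?j) y\<bar> \<partial>lborel)
      = ennreal (?Q x) * ?\<psi> (x ?j)"
      by (rule nn_integral_cmult) measurable
    finally show "(\<integral>\<^sup>+y. ennreal \<bar>?P x - ?Q x\<bar> * ennreal (?a (x ?j) y)
        + ennreal (?Q x) * ennreal \<bar>?a (x ?j) y - ?b (x ?j) y\<bar> \<partial>lborel)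
      = ennreal \<bar>?P x - ?Q x\<bar> * (\<integral>\<^sup>+y. ennreal (?a (x ?j) y) \<partial>lborel)
        + ennreal (?Q x) * ?\<psi> (x ?j)" .
  qed
  also have "\<dots> \<le> (\<integral>\<^sup>+x. ennreal \<bar>?P x - ?Q x\<bar> * 1 + ennreal (?Q x) * ?\<psi> (x ?j) \<partial>?M)"
    by (intro nn_integral_mono add_right_mono mult_left_mono conditional_density_mass_le_1[OF dp ij]) simp
  also have "\<dots> = (\<integral>\<^sup>+x. ennreal \<bar>?P x - ?Q x\<bar> \<partial>?M) + (\<integral>\<^sup>+x. ennreal (?Q x) * ?\<psi> (x ?j) \<partial>?M)"
  proof -
    have "(\<lambda>x. ennreal (?Q x)) \<in> borel_measurable ?M" by measurable
    moreover have "(\<lambda>x. ?\<psi> (x ?j)) \<in> borel_measurable ?M"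
      by (rule measurable_compose[OF comp, of ?\<psi>]) measurable
    ultimately have QM: "(\<lambda>x. ennreal (?Q x) * ?\<psi> (x ?j)) \<in> borel_measurable ?M"
      by (rule borel_measurable_times_ennreal)
    show ?thesis by (simp only: mult_1_right, rule nn_integral_add[OF _ QM]) measurable
  qed
  also have "(\<integral>\<^sup>+x. ennreal (?Q x) * ?\<psi> (x ?j) \<partial>?M) \<le> (\<integral>\<^sup>+t. ennreal (q1 ?j t) * ?\<psi> t \<partial>lborel)"
    by (rule rooted_density_marginal_le[OF dq leaf(1) neq leaf(3)]) measurable
  also have "(\<integral>\<^sup>+t. ennreal (q1 ?j t) * ?\<psi> t \<partial>lborel)
      \<le> (\<integral>\<^sup>+t. (\<integral>\<^sup>+y. ennreal \<bar>p2 v ?j (y, t) - q2 v ?j (y, t)\<bar> \<partial>lborel)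
          + ennreal \<bar>p1 ?j t - q1 ?j t\<bar> \<partial>lborel)"
    by (intro nn_integral_mono conditional_density_diff_le[OF dp dq ij])
  also have "\<dots> = (\<integral>\<^sup>+t. \<integral>\<^sup>+y. ennreal \<bar>p2 v ?j (y, t) - q2 v ?j (y, t)\<bar> \<partial>lborel \<partial>lborel)
      + l1_dist (p1 ?j) (q1 ?j)"
    unfolding l1_dist_def by (rule nn_integral_add) measurable
  also have "(\<integral>\<^sup>+t. \<integral>\<^sup>+y. ennreal \<bar>p2 v ?j (y, t) - q2 v ?j (y, t)\<bar> \<partial>lborel \<partial>lborel)
      = l1_dist (p2 v ?j) (q2 v ?j)"
    unfolding l1_dist_def lborel_prod[symmetric]
    by (subst lborel_pair.nn_integral_snd[symmetric]) (auto simp: lborel_prod)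
  finally have "(\<integral>\<^sup>+x. ennreal \<bar>rooted_density p1 p2 par k (insert v I) x
      - rooted_density q1 q2 par k (insert v I) x\<bar> \<partial>Pi\<^sub>M (insert v I) (\<lambda>_. lborel))
      \<le> (\<integral>\<^sup>+x. ennreal \<bar>?P x - ?Q x\<bar> \<partial>?M)
        + (l1_dist (p2 v ?j) (q2 v ?j) + l1_dist (p1 ?j) (q1 ?j))"
    by (simp add: add_left_mono)
  also have "\<dots> \<le> (l1_dist (p1 k) (q1 k) +
      (\<Sum>i\<in>I - {k}. l1_dist (p2 i (par i)) (q2 i (par i)) + l1_dist (p1 (par i)) (q1 (par i))))
      + (l1_dist (p2 v ?j) (q2 v ?j) + l1_dist (p1 ?j) (q1 ?j))"
    by (rule add_right_mono[OF leaf.IH])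
  also have "\<dots> = l1_dist (p1 k) (q1 k) +
      (\<Sum>i\<in>insert v I - {k}. l1_dist (p2 i (par i)) (q2 i (par i)) + l1_dist (p1 (par i)) (q1 (par i)))"
  proof -
    have "insert v I - {k} = insert v (I - {k})" using \<open>v \<noteq> k\<close> by auto
    then show ?thesis using leaf(2) grown_finite[OF leaf(1)] by (simp add: ac_simps)
  qed
  finally show ?case .
qed

text \<open>
  Lebesgue measure on \<open>real ^ 'd\<close> as a product over the coordinates, so that coordinates can be
  integrated out one by one.
\<close>

lemma nn_integral_lborel_vec:
  fixes g :: "real ^ 'd::finite \<Rightarrow> ennreal"
  assumes [measurable]: "g \<in> borel_measurable borel"
  shows "(\<integral>\<^sup>+x. g x \<partial>lborel) = (\<integral>\<^sup>+x. g (vec_lambda x) \<partial>Pi\<^sub>M UNIV (\<lambda>_. lborel))"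
proof -
  let ?P = "Pi\<^sub>M (UNIV :: 'd set) (\<lambda>_. lborel :: real measure)"
  have vec[measurable]: "(vec_lambda :: _ \<Rightarrow> real ^ 'd) \<in> measurable ?P borel"
  proof (rule borel_measurable_euclidean_space[THEN iffD2], rule ballI)
    fix b :: "real ^ 'd" assume "b \<in> Basis"
    then obtain i where b: "b = axis i 1" by (auto simp: Basis_vec_def)
    show "(\<lambda>x. vec_lambda x \<bullet> b) \<in> borel_measurable ?P"
      unfolding b by (simp add: inner_axis)
  qed
  have "lborel = distr ?P borel vec_lambda"
  proof (rule lborel_eqI)
    fix l u :: "real ^ 'd"
    assume le: "\<And>b. b \<in> Basis \<Longrightarrow> l \<bullet> b \<le> u \<bullet> b"
    have le': "l $ i \<le> u $ i" for i using le[of "axis i 1"] by (simp add: inner_axis)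
    have "emeasure (distr ?P borel vec_lambda) (box l u)
        = emeasure ?P (PiE UNIV (\<lambda>i. {l $ i <..< u $ i}))"
      by (subst emeasure_distr) (auto intro!: arg_cong2[where f = emeasure]
        simp: space_PiM mem_box_cart PiE_def Pi_iff)
    also have "\<dots> = (\<Prod>i\<in>UNIV. emeasure lborel {l $ i <..< u $ i})"
      by (subst lborel_product.emeasure_PiM) auto
    also have "\<dots> = (\<Prod>i\<in>UNIV. ennreal (u $ i - l $ i))" using le' by simp
    also have "\<dots> = ennreal (\<Prod>i\<in>UNIV. u $ i - l $ i)" using le' by (intro prod_ennreal) simp
    also have "(\<Prod>i\<in>UNIV. u $ i - l $ i) = (\<Prod>b\<in>Basis. (u - l) \<bullet> b)"
    proof -
      have B: "(Basis :: (real ^ 'd) set) = (\<lambda>i. axis i 1) ` UNIV" by (auto simp: Basis_vec_def)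
      have "inj (\<lambda>i::'d. axis i (1::real))" by (auto simp: inj_on_def axis_eq_axis)
      then show ?thesis unfolding B by (subst prod.reindex) (auto simp: inner_axis)
    qed
    finally show "emeasure (distr ?P borel vec_lambda) (box l u) = ennreal (\<Prod>b\<in>Basis. (u - l) \<bullet> b)" .
  qed simp
  then have "(\<integral>\<^sup>+x. g x \<partial>lborel) = (\<integral>\<^sup>+x. g x \<partial>distr ?P borel vec_lambda)" by (rule arg_cong)
  then show ?thesis by (simp add: nn_integral_distr)
qed

section \<open>Continuous marginal densities\<close>

lemma dense_if_AE_lborel:
  assumes "AE x in lborel. P (x :: 'b::euclidean_space)"
  shows "closure {x. P x} = UNIV"
proof (rule ccontr)
  assume "closure {x. P x} \<noteq> UNIV"
  then obtain x where "x \<in> - closure {x. P x}" by auto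
  moreover have "open (- closure {x. P x})" by (intro open_Compl closed_closure)
  ultimately obtain e where e: "e > 0" "ball x e \<subseteq> - closure {x. P x}" by (meson open_contains_ball)
  obtain N where N: "{x. \<not> P x} \<subseteq> N" "N \<in> sets lborel" "emeasure lborel N = 0"
    using AE_E[OF assms] by auto
  have "ball x e \<subseteq> N" using e(2) N(1) closure_subset[of "{x. P x}"] by blast
  then have "emeasure lborel (ball x e) = 0"
    using emeasure_mono[of "ball x e" N lborel] N by simp
  then show False using e(1) unit_ball_vol_pos[of "real DIM('b)"] by (simp add: emeasure_ball)
qed

lemma continuous_eq_of_AE_lborel:
  fixes g g' :: "'b::euclidean_space \<Rightarrow> real"
  assumes "continuous_on UNIV g" "continuous_on UNIV g'" "AE z in lborel. g z = g' z"
  shows "g z = g' z"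
proof -
  have "closed {z. g z = g' z}" using assms(1,2) by (rule closed_Collect_eq)
  then have "{z. g z = g' z} = UNIV" using dense_if_AE_lborel[OF assms(3)] by simp
  then show ?thesis by blast
qed

text \<open>
  If a continuous function is almost everywhere the marginal of a continuous joint density, then it
  is at least the marginal everywhere: approximate \<open>t\<close> by points of the dense set where equality
  holds and apply Fatou's lemma.
\<close>

lemma marginal_le_of_AE:
  fixes g :: "'b::euclidean_space \<Rightarrow> real \<Rightarrow> real"
  assumes meas: "\<And>t. (\<lambda>s. g s t) \<in> borel_measurable borel" and cont: "\<And>s. continuous_on UNIV (g s)"
    and cu: "continuous_on UNIV u"
    and ae: "AE t in lborel. ennreal (u t) = (\<integral>\<^sup>+s. ennreal (g s t) \<partial>lborel)"
  shows "(\<integral>\<^sup>+s. ennreal (g s t) \<partial>lborel) \<le> ennreal (u t)"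
proof -
  have "t \<in> closure {t. ennreal (u t) = (\<integral>\<^sup>+s. ennreal (g s t) \<partial>lborel)}"
    using dense_if_AE_lborel[OF ae] by simp
  then obtain r where r: "\<And>n. ennreal (u (r n)) = (\<integral>\<^sup>+s. ennreal (g s (r n)) \<partial>lborel)"
    and lim: "r \<longlonglongrightarrow> t"
    unfolding closure_sequential by blast
  have g: "(\<lambda>n. ennreal (g s (r n))) \<longlonglongrightarrow> ennreal (g s t)" for s
    using cont[of s] lim
    by (intro tendsto_ennrealI continuous_on_tendsto_compose[where s=UNIV and f="g s"]) auto
  have u: "(\<lambda>n. ennreal (u (r n))) \<longlonglongrightarrow> ennreal (u t)"
    using cu lim by (intro tendsto_ennrealI continuous_on_tendsto_compose[where s=UNIV and f=u]) auto
  have "(\<integral>\<^sup>+s. ennreal (g s t) \<partial>lborel) = (\<integral>\<^sup>+s. liminf (\<lambda>n. ennreal (g s (r n))) \<partial>lborel)"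
    by (simp only: lim_imp_Liminf[OF sequentially_bot g])
  also have "\<dots> \<le> liminf (\<lambda>n. \<integral>\<^sup>+s. ennreal (g s (r n)) \<partial>lborel)"
    using meas by (intro nn_integral_liminf) auto
  also have "\<dots> = ennreal (u t)" unfolding r[symmetric] by (rule lim_imp_Liminf[OF sequentially_bot u])
  finally show ?thesis .
qed

text \<open>
  A random vector with continuous one- and two-dimensional marginal densities. Continuity upgrades
  the almost sure relations between these densities to pointwise ones.
\<close>

locale continuous_marginals = prob_space +
  fixes X :: "'a \<Rightarrow> real ^ 'd::{finite,linorder}"
    and f1 :: "'d \<Rightarrow> real \<Rightarrow> real" and f2 :: "'d \<Rightarrow> 'd \<Rightarrow> real \<times> real \<Rightarrow> real"
  assumes f1_nonneg: "0 \<le> f1 i t"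
    and f1_density: "distributed M lborel (\<lambda>\<omega>. X \<omega> $ i) (\<lambda>t. ennreal (f1 i t))"
    and f1_cont: "continuous_on UNIV (f1 i)"
    and f2_nonneg: "i \<noteq> j \<Longrightarrow> 0 \<le> f2 i j z"
    and f2_density: "i \<noteq> j \<Longrightarrow>
      distributed M lborel (\<lambda>\<omega>. (X \<omega> $ i, X \<omega> $ j)) (\<lambda>z. ennreal (f2 i j z))"
    and f2_cont: "i \<noteq> j \<Longrightarrow> continuous_on UNIV (f2 i j)"
begin

lemma f2_swap:
  assumes ij: "i \<noteq> j"
  shows "f2 i j (s, t) = f2 j i (t, s)"
proof -
  let ?g = "\<lambda>z. f2 i j (snd z, fst z)"
  have "distributed M (lborel \<Otimes>\<^sub>M lborel) (\<lambda>\<omega>. (X \<omega> $ j, X \<omega> $ i)) (\<lambda>(x, y). ennreal (f2 i j (y, x)))"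
    using f2_density[OF ij] by (intro distributed_swap) (auto simp: lborel_prod intro: sigma_finite_lborel)
  then have "distributed M lborel (\<lambda>\<omega>. (X \<omega> $ j, X \<omega> $ i)) (\<lambda>z. ennreal (?g z))"
    by (simp add: lborel_prod split_beta')
  from distributed_unique[OF this f2_density[OF ij[symmetric]]]
  have "AE z in lborel. ?g z = f2 j i z"
    using f2_nonneg[OF ij] f2_nonneg[OF ij[symmetric]] by simp
  moreover have "continuous_on UNIV ?g"
    by (intro continuous_on_compose2[OF f2_cont[OF ij]] continuous_intros) auto
  ultimately have "?g (t, s) = f2 j i (t, s)"
    using continuous_eq_of_AE_lborel f2_cont[OF ij[symmetric]] by blast
  then show ?thesis by simp
qed

lemma f2_marginal_le:
  assumes ij: "i \<noteq> j"
  shows "(\<integral>\<^sup>+s. ennreal (f2 i j (s, t)) \<partial>lborel) \<le> ennreal (f1 j t)"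
proof (rule marginal_le_of_AE[where g = "\<lambda>s t. f2 i j (s, t)" and u = "f1 j"])
  show "(\<lambda>s. f2 i j (s, t)) \<in> borel_measurable borel" for t
    by (intro borel_measurable_continuous_onI continuous_on_compose2[OF f2_cont[OF ij]] continuous_intros)
      auto
  show "continuous_on UNIV (\<lambda>t. f2 i j (s, t))" for s
    by (intro continuous_on_compose2[OF f2_cont[OF ij]] continuous_intros) auto
  show "AE t in lborel. ennreal (f1 j t) = (\<integral>\<^sup>+s. ennreal (f2 i j (s, t)) \<partial>lborel)"
    using distributed_marginal_eq_joint2[OF sigma_finite_lborel sigma_finite_lborel f1_density]
      f2_density[OF ij] by (simp add: lborel_prod)
qed (rule f1_cont)

lemma dominated_joints_density: "dominated_joints f1 f2"
  unfolding dominated_joints_def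
proof (intro conjI allI impI)
  fix i j :: 'd and s assume ij: "i \<noteq> j"
  have "(\<integral>\<^sup>+t. ennreal (f2 i j (s, t)) \<partial>lborel) = (\<integral>\<^sup>+t. ennreal (f2 j i (t, s)) \<partial>lborel)"
    by (simp only: f2_swap[OF ij])
  also have "\<dots> \<le> ennreal (f1 i s)" using ij by (intro f2_marginal_le) simp
  finally show "(\<integral>\<^sup>+t. ennreal (f2 i j (s, t)) \<partial>lborel) \<le> ennreal (f1 i s)" .
qed (auto intro: f1_nonneg f2_nonneg f2_marginal_le borel_measurable_continuous_onI f1_cont f2_cont)

lemma f2_eq_0:
  assumes ij: "i \<noteq> j" and zero: "f1 i s = 0"
  shows "f2 i j (s, t) = 0"
proof -
  have c: "continuous_on UNIV (\<lambda>t. f2 i j (s, t))"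
    by (intro continuous_on_compose2[OF f2_cont[OF ij]] continuous_intros) auto
  have "(\<integral>\<^sup>+t. ennreal (f2 i j (s, t)) \<partial>lborel) = 0"
    using dominated_jointsD(6)[OF dominated_joints_density ij, of s] zero by simp
  then have "AE t in lborel. f2 i j (s, t) = 0"
    using f2_nonneg[OF ij] borel_measurable_continuous_onI[OF c]
    by (subst (asm) nn_integral_0_iff_AE) (auto simp: ennreal_eq_0_iff intro: antisym)
  then show ?thesis by (rule continuous_eq_of_AE_lborel[OF c continuous_on_const])
qed

text \<open>
  Where all one-dimensional densities are nonzero this is the cancellation of denominators along the
  bijection \<open>bij_betw_edges\<close>. Where some \<open>f1 i\<close> vanishes, the left side is zero by its second product,
  and the right side is zero because \<open>f2 i j\<close> vanishes together with its marginal \<open>f1 i\<close>.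
\<close>

lemma tree_density_eq_rooted_density:
  assumes T: "T \<in> spanning_trees"
  shows "tree_density f1 f2 T x = rooted_density f1 f2 (parent T k) k UNIV (\<lambda>i. x $ i)"
proof (cases "\<exists>i. f1 i (x $ i) = 0")
  case True
  then obtain i where i: "f1 i (x $ i) = 0" ..
  have "(\<Prod>i\<in>UNIV. f1 i (x $ i)) = 0" using i by auto
  moreover have "rooted_density f1 f2 (parent T k) k UNIV (\<lambda>i. x $ i) = 0"
  proof (cases "i = k")
    case False
    then have "f2 i (parent T k i) (x $ i, x $ parent T k i) = 0"
      using parent_neq[OF T] i by (intro f2_eq_0) metis+
    then have "(\<Prod>i\<in>UNIV - {k}. f2 i (parent T k i) (x $ i, x $ parent T k i)
        / f1 (parent T k i) (x $ parent T k i)) = 0"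
      using False by (intro prod_zero) auto
    then show ?thesis unfolding rooted_density_def by simp
  qed (use i in \<open>simp add: rooted_density_def\<close>)
  ultimately show ?thesis by (simp add: tree_density_def)
next
  case False
  let ?p = "parent T k"
  let ?g = "\<lambda>i j. f2 i j (x $ i, x $ j) / (f1 i (x $ i) * f1 j (x $ j))"
  have "(\<Prod>(i, j)\<in>T. ?g i j)
      = (\<Prod>i\<in>UNIV - {k}. case (if i < ?p i then (i, ?p i) else (?p i, i)) of (i, j) \<Rightarrow> ?g i j)"
    by (rule prod.reindex_bij_betw[OF bij_betw_edges[OF T], symmetric])
  also have "\<dots> = (\<Prod>i\<in>UNIV - {k}. ?g i (?p i))"
  proof (rule prod.cong)
    fix i assume "i \<in> UNIV - {k}"
    then have "i \<noteq> ?p i" using parent_neq[OF T, of i k] by auto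
    then show "(case (if i < ?p i then (i, ?p i) else (?p i, i)) of (i, j) \<Rightarrow> ?g i j) = ?g i (?p i)"
      using f2_swap[of i "?p i"] by (auto simp: mult.commute)
  qed simp
  finally have "tree_density f1 f2 T x
      = (\<Prod>i\<in>UNIV - {k}. ?g i (?p i)) * (f1 k (x $ k) * (\<Prod>i\<in>UNIV - {k}. f1 i (x $ i)))"
    unfolding tree_density_def by (simp add: prod.remove[of UNIV k])
  also have "\<dots> = f1 k (x $ k) * (\<Prod>i\<in>UNIV - {k}. ?g i (?p i) * f1 i (x $ i))"
    by (subst prod.distrib) (rule mult.left_commute)
  also have "\<dots> = rooted_density f1 f2 ?p k UNIV (\<lambda>i. x $ i)"
  proof -
    have "f1 i (x $ i) \<noteq> 0" for i using False by blast
    then show ?thesis unfolding rooted_density_def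
      by (intro arg_cong[where f = "(*) _"] prod.cong refl) simp
  qed
  finally show ?thesis .
qed

end

section \<open>The L1 risk of a histogram\<close>

text \<open>
  The cells are the level sets of \<open>c\<close>, and \<open>v\<close> is their common volume.
\<close>

definition histogram :: "('b \<Rightarrow> 'c) \<Rightarrow> real \<Rightarrow> 'b list \<Rightarrow> 'b \<Rightarrow> real" where
  "histogram c v zs z = (\<Sum>w\<leftarrow>zs. of_bool (c w = c z)) / (real (length zs) * v)"

lemma histogram_nonneg: "0 < v \<Longrightarrow> 0 \<le> histogram c v zs z"
  unfolding histogram_def by (intro divide_nonneg_nonneg sum_list_nonneg) auto

lemma histogram_eq_sum:
  "histogram c v zs z =
    (\<Sum>k<length zs. 1 / (real (length zs) * v) * indicator (c -` {c (zs ! k)}) z)"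
proof -
  have "(\<Sum>w\<leftarrow>zs. of_bool (c w = c z)) = (\<Sum>k<length zs. indicator (c -` {c (zs ! k)}) z :: real)"
    by (simp add: sum_list_sum_nth atLeast0LessThan indicator_def of_bool_def eq_commute)
  then show ?thesis unfolding histogram_def by (simp add: sum_divide_distrib)
qed

lemma histogram_measurable:
  fixes c :: "'b::euclidean_space \<Rightarrow> 'c"
  assumes "\<And>y. c -` {y} \<in> sets borel"
  shows "histogram c v zs \<in> borel_measurable borel"
  unfolding histogram_eq_sum[abs_def] using assms
  by (intro borel_measurable_sum borel_measurable_times borel_measurable_const
      borel_measurable_indicator) auto

lemma nn_integral_sum_cells:
  assumes "finite K" "\<And>k. k \<in> K \<Longrightarrow> 0 \<le> g k" "0 \<le> v"
    and "\<And>k. k \<in> K \<Longrightarrow> A k \<in> sets N" "\<And>k. k \<in> K \<Longrightarrow> emeasure N (A k) = ennreal v"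
  shows "(\<integral>\<^sup>+s. ennreal (\<Sum>k\<in>K. g k * indicator (A k) s) \<partial>N) = ennreal (\<Sum>k\<in>K. g k * v)"
proof -
  have "(\<integral>\<^sup>+s. ennreal (\<Sum>k\<in>K. g k * indicator (A k) s) \<partial>N)
      = (\<integral>\<^sup>+s. (\<Sum>k\<in>K. ennreal (g k) * indicator (A k) s) \<partial>N)"
  proof (intro nn_integral_cong)
    fix s
    have "ennreal (\<Sum>k\<in>K. g k * indicator (A k) s) = (\<Sum>k\<in>K. ennreal (g k * indicator (A k) s))"
      using assms(2) by (intro sum_ennreal[symmetric]) auto
    also have "\<dots> = (\<Sum>k\<in>K. ennreal (g k) * indicator (A k) s)"
      by (intro sum.cong refl) (simp split: split_indicator)
    finally show "ennreal (\<Sum>k\<in>K. g k * indicator (A k) s)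
        = (\<Sum>k\<in>K. ennreal (g k) * indicator (A k) s)" .
  qed
  also have "\<dots> = (\<Sum>k\<in>K. \<integral>\<^sup>+s. ennreal (g k) * indicator (A k) s \<partial>N)"
    using assms(4) by (intro nn_integral_sum) auto
  also have "\<dots> = (\<Sum>k\<in>K. ennreal (g k * v))"
    using assms by (intro sum.cong refl) (simp add: nn_integral_cmult_indicator ennreal_mult)
  also have "\<dots> = ennreal (\<Sum>k\<in>K. g k * v)" using assms(2,3) by (intro sum_ennreal) auto
  finally show ?thesis .
qed

lemma histogram_mass_le_1:
  fixes c :: "'b::euclidean_space \<Rightarrow> 'c"
  assumes "\<And>y. c -` {y} \<in> sets borel" "\<And>y. emeasure lborel (c -` {y}) = ennreal v" "0 < v"
  shows "(\<integral>\<^sup>+z. ennreal (histogram c v zs z) \<partial>lborel) \<le> 1"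
proof -
  have "(\<integral>\<^sup>+z. ennreal (histogram c v zs z) \<partial>lborel)
      = ennreal (\<Sum>k<length zs. 1 / (real (length zs) * v) * v)"
    unfolding histogram_eq_sum using assms by (intro nn_integral_sum_cells) auto
  also have "\<dots> \<le> ennreal 1" using assms(3) by (intro ennreal_leI) (cases "length zs = 0", auto)
  finally show ?thesis by simp
qed

text \<open>
  The mean absolute deviation is at most the standard deviation, and the variance of a frequency of
  independent events of probability \<open>m\<close> is \<open>m * (1 - m) / n\<close>.
\<close>

lemma (in prob_space) expected_frequency_deviation:
  fixes Z :: "nat \<Rightarrow> 'a \<Rightarrow> 'b::topological_space"
  assumes n: "n \<ge> 1" and indep: "indep_vars (\<lambda>_. borel) Z {1..n}" and B: "B \<in> sets borel"
    and m: "\<And>k. k \<in> {1..n} \<Longrightarrow> prob (Z k -` B \<inter> space M) = m"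
  shows "(\<integral>\<^sup>+\<omega>. ennreal \<bar>(\<Sum>k=1..n. indicator B (Z k \<omega>)) / real n - m\<bar> \<partial>M)
    \<le> ennreal (sqrt (m / real n))"
proof -
  have rv[measurable]: "Z k \<in> borel_measurable M" if "k \<in> {1..n}" for k
    using indep that unfolding indep_vars_def by auto
  note B[measurable]
  \<comment> \<open>the centred indicators, independent and bounded by \<open>1\<close>\<close>
  define W where "W k \<omega> = indicator B (Z k \<omega>) - m" for k \<omega>
  have W_rv[measurable]: "W k \<in> borel_measurable M" if "k \<in> {1..n}" for k
    unfolding W_def using rv[OF that] by measurable
  have m01: "0 \<le> m" "m \<le> 1" using m[of 1] n by auto
  have W_le: "\<bar>W k \<omega>\<bar> \<le> 1" for k \<omega> using m01 by (auto simp: W_def indicator_def)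
  have W_int: "integrable M (W k)" if "k \<in> {1..n}" for k
    using W_rv[OF that] W_le by (intro integrable_const_bound[where B=1]) auto
  have WW_int: "integrable M (\<lambda>\<omega>. W k \<omega> * W l \<omega>)" if "k \<in> {1..n}" "l \<in> {1..n}" for k l
    using W_rv[OF that(1)] W_rv[OF that(2)] W_le
    by (intro integrable_const_bound[where B=1])
      (auto simp: abs_mult intro!: mult_le_one)
  have ind_exp: "integrable M (\<lambda>\<omega>. indicator B (Z k \<omega>) :: real)"
    "expectation (\<lambda>\<omega>. indicator B (Z k \<omega>)) = m" if "k \<in> {1..n}" for k
  proof -
    have eq: "(indicator B (Z k \<omega>) :: real) = indicator (Z k -` B \<inter> space M) \<omega>" if "\<omega> \<in> space M" for \<omega>
      using that by (auto simp: indicator_def)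
    have s: "Z k -` B \<inter> space M \<in> sets M" using rv[OF that] B by (rule measurable_sets)
    show "integrable M (\<lambda>\<omega>. indicator B (Z k \<omega>) :: real)"
      using rv[OF that] by (intro integrable_const_bound[where B=1]) auto
    show "expectation (\<lambda>\<omega>. indicator B (Z k \<omega>)) = m"
      using s m[OF that] by (subst Bochner_Integration.integral_cong[OF refl eq]) auto
  qed
  have W_mean: "expectation (W k) = 0" if "k \<in> {1..n}" for k
    unfolding W_def using ind_exp[OF that] by (simp add: prob_space)
  have indep_W: "indep_vars (\<lambda>_. borel) W {1..n}"
    unfolding W_def by (rule indep_vars_compose2[OF indep]) measurable
  have cov: "expectation (\<lambda>\<omega>. W k \<omega> * W l \<omega>) = 0" if "k \<in> {1..n}" "l \<in> {1..n}" "k \<noteq> l" for k l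
  proof -
    have "expectation (\<lambda>\<omega>. \<Prod>i\<in>{k, l}. W i \<omega>) = (\<Prod>i\<in>{k, l}. expectation (W i))"
      using that W_int by (intro indep_vars_lebesgue_integral indep_vars_subset[OF indep_W]) auto
    then show ?thesis using that W_mean by simp
  qed
  have var: "expectation (\<lambda>\<omega>. W k \<omega> * W k \<omega>) \<le> m" if "k \<in> {1..n}" for k
  proof -
    have "W k \<omega> * W k \<omega> = indicator B (Z k \<omega>) * (1 - 2 * m) + m * m" for \<omega>
      by (auto simp: W_def indicator_def algebra_simps)
    then have "expectation (\<lambda>\<omega>. W k \<omega> * W k \<omega>) = m * (1 - 2 * m) + m * m"
      using ind_exp[OF that] by (simp add: prob_space)
    also have "\<dots> \<le> m" using m01 by (simp add: algebra_simps)
    finally show ?thesis .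
  qed
  define S where "S \<omega> = (\<Sum>k=1..n. W k \<omega>)" for \<omega>
  have S_rv[measurable]: "S \<in> borel_measurable M" unfolding S_def by measurable
  have S_int: "integrable M S" unfolding S_def using W_int by (intro Bochner_Integration.integrable_sum)
  have S2: "(S \<omega>)\<^sup>2 = (\<Sum>k=1..n. \<Sum>l=1..n. W k \<omega> * W l \<omega>)" for \<omega>
    by (simp add: S_def power2_eq_square sum_product)
  have S2_int: "integrable M (\<lambda>\<omega>. (S \<omega>)\<^sup>2)" unfolding S2
    using WW_int by (intro Bochner_Integration.integrable_sum)
  have "expectation (\<lambda>\<omega>. (S \<omega>)\<^sup>2) = (\<Sum>k=1..n. \<Sum>l=1..n. expectation (\<lambda>\<omega>. W k \<omega> * W l \<omega>))"
    unfolding S2 using WW_int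
    by (subst Bochner_Integration.integral_sum) (auto intro!: Bochner_Integration.integrable_sum)
  also have "\<dots> = (\<Sum>k=1..n. \<Sum>l=1..n. if l = k then expectation (\<lambda>\<omega>. W k \<omega> * W k \<omega>) else 0)"
    using cov by (intro sum.cong refl) auto
  also have "\<dots> = (\<Sum>k=1..n. expectation (\<lambda>\<omega>. W k \<omega> * W k \<omega>))"
    by (intro sum.cong refl) (simp add: sum.delta)
  also have "\<dots> \<le> (\<Sum>k=1..n. m)" by (intro sum_mono var)
  finally have S2_le: "expectation (\<lambda>\<omega>. (S \<omega>)\<^sup>2) \<le> real n * m" by simp
  \<comment> \<open>Jensen for the square, as nonnegativity of the variance of \<open>\<bar>S\<bar>\<close>\<close>
  have "(expectation (\<lambda>\<omega>. \<bar>S \<omega>\<bar>))\<^sup>2 \<le> expectation (\<lambda>\<omega>. (S \<omega>)\<^sup>2)"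
    using variance_positive[of "\<lambda>\<omega>. \<bar>S \<omega>\<bar>"] variance_eq[of "\<lambda>\<omega>. \<bar>S \<omega>\<bar>"] S_int S2_int by simp
  then have "expectation (\<lambda>\<omega>. \<bar>S \<omega>\<bar>) \<le> sqrt (real n * m)"
    using S2_le by (intro real_le_rsqrt) simp
  then have "expectation (\<lambda>\<omega>. \<bar>S \<omega>\<bar>) / real n \<le> sqrt (real n * m) / real n"
    by (rule divide_right_mono) simp
  also have "\<dots> = sqrt (m / real n)"
    using n by (simp add: real_sqrt_mult real_sqrt_divide field_simps)
  finally have *: "expectation (\<lambda>\<omega>. \<bar>S \<omega>\<bar>) / real n \<le> sqrt (m / real n)" .
  have "(\<Sum>k=1..n. indicator B (Z k \<omega>)) / real n - m = S \<omega> / real n" for \<omega>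
    using n by (simp add: S_def W_def sum_subtractf field_simps)
  then have "(\<integral>\<^sup>+\<omega>. ennreal \<bar>(\<Sum>k=1..n. indicator B (Z k \<omega>)) / real n - m\<bar> \<partial>M)
      = (\<integral>\<^sup>+\<omega>. ennreal (\<bar>S \<omega>\<bar> / real n) \<partial>M)"
    by (simp add: abs_divide)
  also have "\<dots> = ennreal (expectation (\<lambda>\<omega>. \<bar>S \<omega>\<bar> / real n))"
    using S_int by (intro nn_integral_eq_integral) auto
  also have "expectation (\<lambda>\<omega>. \<bar>S \<omega>\<bar> / real n) = expectation (\<lambda>\<omega>. \<bar>S \<omega>\<bar>) / real n" by simp
  finally show ?thesis using * by (simp add: ennreal_leI)
qed

lemma sum_sqrt_le:
  fixes a :: "'c \<Rightarrow> real"
  assumes "\<And>y. y \<in> Y \<Longrightarrow> 0 \<le> a y" "(\<Sum>y\<in>Y. a y) \<le> 1"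
  shows "(\<Sum>y\<in>Y. sqrt (a y)) \<le> sqrt (card Y)"
proof (rule real_le_rsqrt)
  have "(\<Sum>y\<in>Y. 1 * sqrt (a y))\<^sup>2 \<le> (\<Sum>y\<in>Y. 1\<^sup>2) * (\<Sum>y\<in>Y. (sqrt (a y))\<^sup>2)"
    by (rule Cauchy_Schwarz_ineq_sum)
  also have "\<dots> = real (card Y) * (\<Sum>y\<in>Y. a y)" using assms(1) by simp
  also have "\<dots> \<le> real (card Y) * 1" using assms(2) by (intro mult_left_mono) auto
  finally show "(\<Sum>y\<in>Y. sqrt (a y))\<^sup>2 \<le> card Y" by simp
qed

text \<open>
  On a cell of probability \<open>m\<close> the error is at most \<open>\<bar>frequency - m\<bar> / v\<close> plus the distance of \<open>q\<close> from
  its mean \<open>m / v\<close> over the cell, which is at most \<open>L * \<delta>\<close> by the Lipschitz condition. Outside the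
  cells that meet \<open>S\<close> both the histogram and \<open>q\<close> vanish. Integrating over a cell multiplies by \<open>v\<close>, and
  the expected frequency deviations sum up by Cauchy-Schwarz.
\<close>

lemma (in prob_space) histogram_risk:
  fixes Z :: "nat \<Rightarrow> 'a \<Rightarrow> 'b::euclidean_space" and c :: "'b \<Rightarrow> 'c::countable"
    and q :: "'b \<Rightarrow> real" and L v \<delta> :: real
  assumes n: "n \<ge> 1" and indep: "indep_vars (\<lambda>_. borel) Z {1..n}"
    and dist: "\<And>k. k \<in> {1..n} \<Longrightarrow> distributed M lborel (Z k) (\<lambda>z. ennreal (q z))"
    and q0: "\<And>z. 0 \<le> q z" and lip: "L-lipschitz_on UNIV q"
    and supp: "S \<in> sets borel" "\<And>k. k \<in> {1..n} \<Longrightarrow> AE \<omega> in M. Z k \<omega> \<in> S"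
    and c[measurable]: "c \<in> measurable borel (count_space UNIV)"
    and v: "0 < v" "\<And>y. emeasure lborel (c -` {y}) = ennreal v"
    and diam: "\<And>z z'. c z = c z' \<Longrightarrow> dist z z' \<le> \<delta>"
    and Y: "finite (c ` S)"
  shows "(\<integral>\<^sup>+\<omega>. l1_dist (histogram c v (map (\<lambda>k. Z k \<omega>) [1..<Suc n])) q \<partial>M)
    \<le> ennreal (sqrt (card (c ` S) / real n) + card (c ` S) * (v * (L * \<delta>)))"
proof -
  let ?Y = "c ` S"
  let ?cell = "\<lambda>y. c -` {y}"
  let ?H = "\<lambda>\<omega>. histogram c v (map (\<lambda>k. Z k \<omega>) [1..<Suc n])"
  have L0: "0 \<le> L" using lip lipschitz_on_nonneg by blast
  have \<delta>0: "0 \<le> \<delta>" using diam[of 0 0] by simp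
  have rv[measurable]: "Z k \<in> borel_measurable M" if "k \<in> {1..n}" for k
    using indep that unfolding indep_vars_def by auto
  have q_meas[measurable]: "q \<in> borel_measurable borel"
    using lip by (intro borel_measurable_continuous_onI lipschitz_on_continuous_on)
  have cell[measurable]: "?cell y \<in> sets borel" for y
    using measurable_sets[OF c, of "{y}"] by simp
  define m where "m y = prob (Z 1 -` ?cell y \<inter> space M)" for y
  have m_eq: "emeasure M (Z k -` ?cell y \<inter> space M) = (\<integral>\<^sup>+z. ennreal (q z) * indicator (?cell y) z \<partial>lborel)"
    if "k \<in> {1..n}" for k y
    using distributed_emeasure[OF dist[OF that], of "?cell y"] by simp
  have m_ennreal: "ennreal (m y) = (\<integral>\<^sup>+z. ennreal (q z) * indicator (?cell y) z \<partial>lborel)" for y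
    using m_eq[of 1 y] n unfolding m_def by (simp add: emeasure_eq_measure)
  have m_prob: "prob (Z k -` ?cell y \<inter> space M) = m y" if "k \<in> {1..n}" for k y
  proof -
    have "ennreal (prob (Z k -` ?cell y \<inter> space M)) = ennreal (m y)"
      using m_eq[OF that, of y] m_ennreal[of y] by (simp add: emeasure_eq_measure)
    then show ?thesis by (simp add: m_def)
  qed
  \<comment> \<open>comparison of \<open>m (c z)\<close>, the integral of \<open>q\<close> over the cell of \<open>z\<close>, with \<open>v * q z\<close>\<close>
  have bias: "\<bar>m (c z) / v - q z\<bar> \<le> L * \<delta>" for z
  proof -
    have q_near: "\<bar>q z' - q z\<bar> \<le> L * \<delta>" if "c z' = c z" for z'
    proof -
      have "\<bar>q z' - q z\<bar> \<le> L * dist z' z" using lipschitz_onD[OF lip, of z' z] by (simp add: dist_real_def)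
      also have "\<dots> \<le> L * \<delta>" using diam[OF that] L0 by (intro mult_left_mono)
      finally show ?thesis .
    qed
    have "ennreal (m (c z)) \<le> (\<integral>\<^sup>+z'. ennreal (q z + L * \<delta>) * indicator (?cell (c z)) z' \<partial>lborel)"
      unfolding m_ennreal
      by (intro nn_integral_mono) (use q_near in \<open>force simp: indicator_def intro!: ennreal_leI\<close>)
    also have "\<dots> = ennreal ((q z + L * \<delta>) * v)"
      using v q0[of z] L0 \<delta>0 by (simp add: nn_integral_cmult_indicator ennreal_mult)
    finally have up: "m (c z) \<le> (q z + L * \<delta>) * v"
      using v q0[of z] L0 \<delta>0 by (subst (asm) ennreal_le_iff) auto
    have "ennreal (q z * v) = (\<integral>\<^sup>+z'. ennreal (q z) * indicator (?cell (c z)) z' \<partial>lborel)"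
      using v q0[of z] by (simp add: nn_integral_cmult_indicator ennreal_mult)
    also have "\<dots> \<le> (\<integral>\<^sup>+z'. ennreal (q z') * indicator (?cell (c z)) z'
        + ennreal (L * \<delta>) * indicator (?cell (c z)) z' \<partial>lborel)"
    proof (intro nn_integral_mono)
      fix z'
      have "ennreal (q z) \<le> ennreal (q z') + ennreal (L * \<delta>)" if "c z' = c z"
      proof -
        have "ennreal (q z) \<le> ennreal (q z' + L * \<delta>)"
          using q_near[OF that] by (intro ennreal_leI) linarith
        then show ?thesis using q0[of z'] L0 \<delta>0 by simp
      qed
      then show "ennreal (q z) * indicator (?cell (c z)) z' \<le> ennreal (q z') * indicator (?cell (c z)) z'
        + ennreal (L * \<delta>) * indicator (?cell (c z)) z'"
        by (auto simp: indicator_def)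
    qed
    also have "\<dots> = ennreal (m (c z)) + ennreal (L * \<delta> * v)"
      unfolding m_ennreal using v L0 \<delta>0
      by (subst nn_integral_add) (auto simp: nn_integral_cmult_indicator ennreal_mult)
    also have "\<dots> = ennreal (m (c z) + L * \<delta> * v)"
      using v L0 \<delta>0 by (simp add: m_def)
    finally have "q z * v \<le> m (c z) + L * \<delta> * v"
      using v L0 \<delta>0 by (subst (asm) ennreal_le_iff) (auto simp: m_def)
    then show ?thesis using up v by (simp add: abs_le_iff field_simps)
  qed
  have "AE \<omega> in M. Z 1 \<omega> \<in> S" using supp(2)[of 1] n by simp
  then have q_supp: "AE z in lborel. 0 < q z \<longrightarrow> z \<in> S"
    using distributed_AE2[OF dist[of 1], of "\<lambda>z. z \<in> S"] supp(1) n by simp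
  define fr where "fr y \<omega> = (\<Sum>k=1..n. indicator (?cell y) (Z k \<omega>)) / real n" for y \<omega>
  have fr_rv[measurable]: "fr y \<in> borel_measurable M" for y unfolding fr_def by measurable
  have hist: "?H \<omega> z = fr (c z) \<omega> / v" for \<omega> z
  proof -
    have "(\<Sum>w\<leftarrow>map (\<lambda>k. Z k \<omega>) [1..<Suc n]. of_bool (c w = c z))
      = (\<Sum>k=1..n. indicator (?cell (c z)) (Z k \<omega>) :: real)"
      by (simp only: list.map_comp o_def interv_sum_list_conv_sum_set_nat set_upt
          atLeastLessThanSuc_atLeastAtMost) (simp add: indicator_def of_bool_def)
    then show ?thesis unfolding histogram_def fr_def by (simp del: upt_Suc)
  qed
  have pw: "\<bar>?H \<omega> z - q z\<bar> \<le> (\<Sum>y\<in>?Y. (\<bar>fr y \<omega> - m y\<bar> / v + L * \<delta>) * indicator (?cell y) z)"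
    if Z: "\<And>k. k \<in> {1..n} \<Longrightarrow> Z k \<omega> \<in> S" and z: "0 < q z \<longrightarrow> z \<in> S" for \<omega> z
  proof (cases "c z \<in> ?Y")
    case True
    have "(\<Sum>y\<in>?Y. (\<bar>fr y \<omega> - m y\<bar> / v + L * \<delta>) * indicator (?cell y) z)
      = (\<Sum>y\<in>?Y. if y = c z then \<bar>fr y \<omega> - m y\<bar> / v + L * \<delta> else 0)"
      by (intro sum.cong) (auto simp: indicator_def)
    also have "\<dots> = \<bar>fr (c z) \<omega> - m (c z)\<bar> / v + L * \<delta>" using True Y by (simp add: sum.delta)
    finally have sum: "(\<Sum>y\<in>?Y. (\<bar>fr y \<omega> - m y\<bar> / v + L * \<delta>) * indicator (?cell y) z)
      = \<bar>fr (c z) \<omega> - m (c z)\<bar> / v + L * \<delta>" .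
    have "?H \<omega> z - q z = (fr (c z) \<omega> - m (c z)) / v + (m (c z) / v - q z)"
      unfolding hist by (simp add: diff_divide_distrib)
    also have "\<bar>\<dots>\<bar> \<le> \<bar>(fr (c z) \<omega> - m (c z)) / v\<bar> + \<bar>m (c z) / v - q z\<bar>" by (rule abs_triangle_ineq)
    also have "\<dots> \<le> \<bar>fr (c z) \<omega> - m (c z)\<bar> / v + L * \<delta>" using bias[of z] v by (simp add: abs_divide)
    finally show ?thesis unfolding sum .
  next
    case False
    then have "z \<notin> S" by auto
    then have "q z = 0" using z q0[of z] by auto
    moreover have "fr (c z) \<omega> = 0"
    proof -
      have "indicator (?cell (c z)) (Z k \<omega>) = (0::real)" if "k \<in> {1..n}" for k
        using Z[OF that] False by (auto simp: indicator_def image_iff) 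
      then show ?thesis by (simp add: fr_def)
    qed
    ultimately show ?thesis unfolding hist using v L0 \<delta>0 by (auto intro!: sum_nonneg)
  qed
  have int: "l1_dist (?H \<omega>) q \<le> (\<Sum>y\<in>?Y. ennreal \<bar>fr y \<omega> - m y\<bar> + ennreal (v * (L * \<delta>)))"
    if Z: "\<And>k. k \<in> {1..n} \<Longrightarrow> Z k \<omega> \<in> S" for \<omega>
  proof -
    have "l1_dist (?H \<omega>) q \<le> (\<integral>\<^sup>+z. (\<Sum>y\<in>?Y. ennreal (\<bar>fr y \<omega> - m y\<bar> / v + L * \<delta>)
        * indicator (?cell y) z) \<partial>lborel)"
      unfolding l1_dist_def
    proof (rule nn_integral_mono_AE, rule AE_mp[OF q_supp], rule AE_I2, rule impI)
      fix z assume "0 < q z \<longrightarrow> z \<in> S"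
      from pw[OF Z this] have "ennreal \<bar>?H \<omega> z - q z\<bar>
        \<le> ennreal (\<Sum>y\<in>?Y. (\<bar>fr y \<omega> - m y\<bar> / v + L * \<delta>) * indicator (?cell y) z)"
        by (intro ennreal_leI) simp
      also have "\<dots> = (\<Sum>y\<in>?Y. ennreal ((\<bar>fr y \<omega> - m y\<bar> / v + L * \<delta>) * indicator (?cell y) z))"
        using v L0 \<delta>0 by (intro sum_ennreal[symmetric]) auto
      also have "\<dots> = (\<Sum>y\<in>?Y. ennreal (\<bar>fr y \<omega> - m y\<bar> / v + L * \<delta>) * indicator (?cell y) z)"
        by (intro sum.cong refl) (simp split: split_indicator)
      finally show "ennreal \<bar>?H \<omega> z - q z\<bar>
        \<le> (\<Sum>y\<in>?Y. ennreal (\<bar>fr y \<omega> - m y\<bar> / v + L * \<delta>) * indicator (?cell y) z)" .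
    qed
    also have "\<dots> = (\<Sum>y\<in>?Y. ennreal (\<bar>fr y \<omega> - m y\<bar> / v + L * \<delta>) * ennreal v)"
      by (subst nn_integral_sum) (auto simp: nn_integral_cmult_indicator v(2))
    also have "\<dots> = (\<Sum>y\<in>?Y. ennreal \<bar>fr y \<omega> - m y\<bar> + ennreal (v * (L * \<delta>)))"
    proof (rule sum.cong[OF refl])
      fix y
      have "ennreal (\<bar>fr y \<omega> - m y\<bar> / v + L * \<delta>) * ennreal v
          = ennreal ((\<bar>fr y \<omega> - m y\<bar> / v + L * \<delta>) * v)"
        using v L0 \<delta>0 by (intro ennreal_mult[symmetric]) auto
      also have "(\<bar>fr y \<omega> - m y\<bar> / v + L * \<delta>) * v = \<bar>fr y \<omega> - m y\<bar> + v * (L * \<delta>)"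
        using v by (simp add: field_simps)
      finally show "ennreal (\<bar>fr y \<omega> - m y\<bar> / v + L * \<delta>) * ennreal v
          = ennreal \<bar>fr y \<omega> - m y\<bar> + ennreal (v * (L * \<delta>))"
        using v L0 \<delta>0 by simp
    qed
    finally show ?thesis .
  qed
  have "AE \<omega> in M. \<forall>k\<in>{1..n}. Z k \<omega> \<in> S" using supp(2) by (intro AE_finite_allI) auto
  then have "(\<integral>\<^sup>+\<omega>. l1_dist (?H \<omega>) q \<partial>M)
      \<le> (\<integral>\<^sup>+\<omega>. (\<Sum>y\<in>?Y. ennreal \<bar>fr y \<omega> - m y\<bar> + ennreal (v * (L * \<delta>))) \<partial>M)"
  proof (intro nn_integral_mono_AE, elim eventually_mono)
    fix \<omega> assume "\<forall>k\<in>{1..n}. Z k \<omega> \<in> S"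
    then show "l1_dist (?H \<omega>) q \<le> (\<Sum>y\<in>?Y. ennreal \<bar>fr y \<omega> - m y\<bar> + ennreal (v * (L * \<delta>)))"
      by (intro int) blast
  qed
  also have "\<dots> = (\<Sum>y\<in>?Y. (\<integral>\<^sup>+\<omega>. ennreal \<bar>fr y \<omega> - m y\<bar> \<partial>M) + ennreal (v * (L * \<delta>)))"
    by (subst nn_integral_sum) (auto simp: nn_integral_add emeasure_space_1)
  also have "\<dots> \<le> (\<Sum>y\<in>?Y. ennreal (sqrt (m y / real n)) + ennreal (v * (L * \<delta>)))"
    unfolding fr_def
    by (intro sum_mono add_right_mono expected_frequency_deviation[OF n indep cell m_prob])
  also have "\<dots> = ennreal (\<Sum>y\<in>?Y. sqrt (m y / real n) + v * (L * \<delta>))"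
    using v L0 \<delta>0 by (subst sum_ennreal[symmetric]) (auto intro!: sum.cong simp: m_def)
  also have "\<dots> \<le> ennreal (sqrt (card ?Y / real n) + card ?Y * (v * (L * \<delta>)))"
  proof (rule ennreal_leI)
    have vs: "Z 1 -` ?cell y \<inter> space M \<in> sets M" for y
      using measurable_sets[OF rv[of 1] cell] n by simp
    have "(\<Sum>y\<in>?Y. m y) = prob (\<Union>y\<in>?Y. Z 1 -` ?cell y \<inter> space M)"
      unfolding m_def using Y vs
      by (intro finite_measure_finite_Union[symmetric]) (auto simp: disjoint_family_on_def)
    then have "(\<Sum>y\<in>?Y. m y) \<le> 1" by simp
    then have "(\<Sum>y\<in>?Y. sqrt (m y)) / sqrt (real n) \<le> sqrt (card ?Y) / sqrt (real n)"
      by (intro divide_right_mono sum_sqrt_le) (auto simp: m_def)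
    then show "(\<Sum>y\<in>?Y. sqrt (m y / real n) + v * (L * \<delta>))
        \<le> sqrt (card ?Y / real n) + card ?Y * (v * (L * \<delta>))"
      by (simp add: sum.distrib real_sqrt_divide sum_divide_distrib)
  qed
  finally show ?thesis .
qed

lemma (in prob_space) histogram_l1_measurable:
  fixes Z :: "nat \<Rightarrow> 'a \<Rightarrow> 'b::euclidean_space" and c :: "'b \<Rightarrow> 'c::countable"
  assumes rv: "\<And>k. k \<in> {1..n} \<Longrightarrow> Z k \<in> borel_measurable M"
    and c[measurable]: "c \<in> measurable borel (count_space UNIV)"
    and q[measurable]: "q \<in> borel_measurable borel"
  shows "(\<lambda>\<omega>. l1_dist (histogram c v (map (\<lambda>k. Z k \<omega>) [1..<Suc n])) q) \<in> borel_measurable M"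
proof -
  have eq: "histogram c v (map (\<lambda>k. Z k \<omega>) [1..<Suc n]) z
      = (\<Sum>k=1..n. of_bool (\<exists>y. c (Z k \<omega>) = y \<and> c z = y)) / (real n * v)" for \<omega> z
  proof -
    have "(\<Sum>w\<leftarrow>map (\<lambda>k. Z k \<omega>) [1..<Suc n]. of_bool (c w = c z))
      = (\<Sum>k=1..n. of_bool (\<exists>y. c (Z k \<omega>) = y \<and> c z = y) :: real)"
      by (simp only: list.map_comp o_def interv_sum_list_conv_sum_set_nat set_upt
          atLeastLessThanSuc_atLeastAtMost) (intro sum.cong refl, auto)
    then show ?thesis unfolding histogram_def by (simp del: upt_Suc)
  qed
  have "(\<lambda>(\<omega>, z). of_bool (\<exists>y. c (Z k \<omega>) = y \<and> c z = y) :: real) \<in> borel_measurable (M \<Otimes>\<^sub>M lborel)"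
    if "k \<in> {1..n}" for k
  proof -
    note [measurable] = rv[OF that]
    show ?thesis unfolding of_bool_def by measurable
  qed
  then have "(\<lambda>p. \<Sum>k=1..n. of_bool (\<exists>y. c (Z k (fst p)) = y \<and> c (snd p) = y) :: real)
      \<in> borel_measurable (M \<Otimes>\<^sub>M lborel)"
    by (intro borel_measurable_sum) (simp add: case_prod_beta')
  then have "(\<lambda>(\<omega>, z). ennreal \<bar>histogram c v (map (\<lambda>k. Z k \<omega>) [1..<Suc n]) z - q z\<bar>)
      \<in> borel_measurable (M \<Otimes>\<^sub>M lborel)"
    unfolding eq case_prod_beta'
    by (intro measurable_compose[OF _ measurable_ennreal] borel_measurable_abs borel_measurable_diff
        borel_measurable_divide borel_measurable_const) auto
  then show ?thesis unfolding l1_dist_def by (rule lborel.borel_measurable_nn_integral)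
qed

text \<open>
  The same risk in terms of a bin width \<open>h\<close>, with a constant that serves all \<open>h\<close>. For \<open>h \<le> 1\<close> the
  number of cells is of the order \<open>1 / h\<^sup>2\<close> at most; for \<open>h > 1\<close> any two densities have \<open>L\<^sup>1\<close> distance at
  most \<open>2 \<le> 2 * h\<close>. The quadratic cell count is crude in dimension one, but it lets one lemma cover
  both marginal and joint histograms.
\<close>

lemma (in prob_space) histogram_risk_rate:
  fixes Z :: "nat \<Rightarrow> 'a \<Rightarrow> 'b::euclidean_space" and c :: "'b \<Rightarrow> 'c::countable"
    and q :: "'b \<Rightarrow> real" and L v h D :: real
  assumes n: "n \<ge> 1" and indep: "indep_vars (\<lambda>_. borel) Z {1..n}"
    and dist: "\<And>k. k \<in> {1..n} \<Longrightarrow> distributed M lborel (Z k) (\<lambda>z. ennreal (q z))"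
    and q0: "\<And>z. 0 \<le> q z" and lip: "L-lipschitz_on UNIV q"
    and supp: "S \<in> sets borel" "\<And>k. k \<in> {1..n} \<Longrightarrow> AE \<omega> in M. Z k \<omega> \<in> S"
    and c[measurable]: "c \<in> measurable borel (count_space UNIV)"
    and v: "0 < v" "\<And>y. emeasure lborel (c -` {y}) = ennreal v"
    and h: "0 < h" and diam: "\<And>z z'. c z = c z' \<Longrightarrow> dist z z' \<le> 2 * h"
    and Y: "finite (c ` S)" and D: "0 \<le> D"
    and card: "h \<le> 1 \<Longrightarrow> real (card (c ` S)) \<le> (D / h)\<^sup>2" "h \<le> 1 \<Longrightarrow> card (c ` S) * v \<le> D\<^sup>2"
  shows "(\<integral>\<^sup>+\<omega>. l1_dist (histogram c v (map (\<lambda>k. Z k \<omega>) [1..<Suc n])) q \<partial>M)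
    \<le> ennreal ((2 + D + 2 * L * D\<^sup>2) * (1 / sqrt (real n * h\<^sup>2) + h))"
proof (cases "h \<le> 1")
  case True
  have L0: "0 \<le> L" using lip lipschitz_on_nonneg by blast
  let ?N = "real (card (c ` S))"
  let ?r = "1 / sqrt (real n * h\<^sup>2)"
  have r: "sqrt (real n * h\<^sup>2) = sqrt (real n) * h" using h by (simp add: real_sqrt_mult)
  have "(\<integral>\<^sup>+\<omega>. l1_dist (histogram c v (map (\<lambda>k. Z k \<omega>) [1..<Suc n])) q \<partial>M)
      \<le> ennreal (sqrt (?N / real n) + ?N * (v * (L * (2 * h))))"
    by (rule histogram_risk[OF n indep dist q0 lip supp c v diam Y])
  also have "\<dots> \<le> ennreal ((2 + D + 2 * L * D\<^sup>2) * (?r + h))"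
  proof (rule ennreal_leI)
    have "sqrt ?N \<le> D / h" using card(1)[OF True] D h by (simp add: real_le_lsqrt)
    then have "sqrt (?N / real n) \<le> D / h / sqrt (real n)"
      unfolding real_sqrt_divide by (rule divide_right_mono) simp
    also have "\<dots> = D * ?r" unfolding r by (simp add: field_simps)
    finally have 1: "sqrt (?N / real n) \<le> D * ?r" .
    have "?N * (v * (L * (2 * h))) = (?N * v) * (2 * L * h)" by simp
    also have "\<dots> \<le> D\<^sup>2 * (2 * L * h)" using card(2)[OF True] L0 h by (intro mult_right_mono) auto
    finally have 2: "?N * (v * (L * (2 * h))) \<le> (2 * L * D\<^sup>2) * h" by (simp add: ac_simps)
    have "D * ?r \<le> (2 + D + 2 * L * D\<^sup>2) * ?r" "(2 * L * D\<^sup>2) * h \<le> (2 + D + 2 * L * D\<^sup>2) * h"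
      using L0 D h by (auto intro!: mult_right_mono divide_right_mono)
    with 1 2 show "sqrt (?N / real n) + ?N * (v * (L * (2 * h))) \<le> (2 + D + 2 * L * D\<^sup>2) * (?r + h)"
      unfolding distrib_left by linarith
  qed
  finally show ?thesis .
next
  case False
  have L0: "0 \<le> L" using lip lipschitz_on_nonneg by blast
  have q_meas: "q \<in> borel_measurable borel"
    using lip by (intro borel_measurable_continuous_onI lipschitz_on_continuous_on)
  have cell: "c -` {y} \<in> sets borel" for y using measurable_sets[OF c, of "{y}"] by simp
  have "l1_dist (histogram c v zs) q \<le> 2" for zs
  proof -
    have "l1_dist (histogram c v zs) q
        \<le> (\<integral>\<^sup>+z. ennreal (histogram c v zs z) + ennreal (q z) \<partial>lborel)"
      unfolding l1_dist_def
      using q0 histogram_nonneg[OF v(1), of c zs]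
      by (intro nn_integral_mono) (simp flip: ennreal_plus add: ennreal_leI abs_le_iff add_increasing2)
    also have "\<dots> = (\<integral>\<^sup>+z. ennreal (histogram c v zs z) \<partial>lborel) + (\<integral>\<^sup>+z. ennreal (q z) \<partial>lborel)"
      using histogram_measurable[OF cell, of v zs] q_meas by (intro nn_integral_add) auto
    also have "(\<integral>\<^sup>+z. ennreal (q z) \<partial>lborel) = 1"
      using distributed_nn_integral[OF dist[of 1], of "\<lambda>_. 1"] n by (simp add: emeasure_space_1)
    also have "(\<integral>\<^sup>+z. ennreal (histogram c v zs z) \<partial>lborel) + 1 \<le> 1 + 1"
      by (intro add_right_mono histogram_mass_le_1 cell v)
    finally show ?thesis by simp
  qed
  then have "(\<integral>\<^sup>+\<omega>. l1_dist (histogram c v (map (\<lambda>k. Z k \<omega>) [1..<Suc n])) q \<partial>M) \<le> (\<integral>\<^sup>+\<omega>. 2 \<partial>M)"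
    by (intro nn_integral_mono)
  also have "\<dots> = ennreal (2 * 1)" by (simp add: emeasure_space_1)
  also have "\<dots> \<le> ennreal ((2 + D + 2 * L * D\<^sup>2) * (1 / sqrt (real n * h\<^sup>2) + h))"
  proof (intro ennreal_leI mult_mono)
    have "0 \<le> 1 / sqrt (real n * h\<^sup>2)" by simp
    then show "1 \<le> 1 / sqrt (real n * h\<^sup>2) + h" using False by linarith
  qed (use L0 D in auto)
  finally show ?thesis .
qed

section \<open>Uniform partitions\<close>

definition bin :: "real \<Rightarrow> real \<Rightarrow> real \<Rightarrow> int" where
  "bin a h t = \<lfloor>(t - a) / h\<rfloor>"

definition bin2 :: "real \<Rightarrow> real \<Rightarrow> real \<times> real \<Rightarrow> int \<times> int" where
  "bin2 a h z = (bin a h (fst z), bin a h (snd z))"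

lemma bin_eq_iff:
  "h > 0 \<Longrightarrow> bin a h t = m \<longleftrightarrow> t \<in> {a + of_int m * h ..< a + (of_int m + 1) * h}"
  unfolding bin_def floor_eq_iff by (simp add: field_simps)

lemma uniform_partition_cell:
  assumes "uniform_partition h P"
  obtains a where "\<And>s t. s \<in> cell P t \<longleftrightarrow> bin a h s = bin a h t"
proof -
  obtain a where h: "h > 0"
    and P: "P = range (\<lambda>m::int. {a + of_int m * h ..< a + (of_int m + 1) * h})"
    using assms unfolding uniform_partition_def by auto
  have "cell P t = {a + of_int (bin a h t) * h ..< a + (of_int (bin a h t) + 1) * h}" for t
    unfolding cell_def
  proof (rule the_equality)
    show "{a + of_int (bin a h t) * h ..< a + (of_int (bin a h t) + 1) * h} \<in> P \<and>
        t \<in> {a + of_int (bin a h t) * h ..< a + (of_int (bin a h t) + 1) * h}"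
      using bin_eq_iff[OF h, of a t "bin a h t"] unfolding P by blast
    fix A assume "A \<in> P \<and> t \<in> A"
    then obtain m where "A = {a + of_int m * h ..< a + (of_int m + 1) * h}" "t \<in> A"
      unfolding P by blast
    then show "A = {a + of_int (bin a h t) * h ..< a + (of_int (bin a h t) + 1) * h}"
      using bin_eq_iff[OF h, of a t m] by simp
  qed
  then have "s \<in> cell P t \<longleftrightarrow> bin a h s = bin a h t" for s t
    using bin_eq_iff[OF h, of a s "bin a h t"] by simp
  then show thesis by (rule that)
qed

context
  fixes a h :: real
  assumes h: "h > 0"
begin

lemma bin_vimage: "bin a h -` {m} = {a + of_int m * h ..< a + (of_int m + 1) * h}"
  using bin_eq_iff[OF h] by blast

lemma bin_cell_sets: "bin a h -` {m} \<in> sets borel"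
  unfolding bin_vimage by simp

lemma emeasure_bin_cell: "emeasure lborel (bin a h -` {m}) = ennreal h"
  unfolding bin_vimage using h by (simp add: algebra_simps)

lemma bin_measurable: "bin a h \<in> measurable borel (count_space UNIV)"
  using bin_cell_sets by (simp add: measurable_count_space_eq2_countable)

lemma bin_eq_imp_dist_le: "bin a h s = bin a h t \<Longrightarrow> dist s t \<le> h"
  using bin_eq_iff[OF h, of a s "bin a h t"] bin_eq_iff[OF h, of a t "bin a h t"]
  by (auto simp: dist_real_def algebra_simps abs_le_iff)

lemma bin2_vimage: "bin2 a h -` {m} = (bin a h -` {fst m}) \<times> (bin a h -` {snd m})"
  by (auto simp: bin2_def)

lemma bin2_cell_sets: "bin2 a h -` {m} \<in> sets borel"
  unfolding bin2_vimage using bin_cell_sets by (intro borel_Times)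

lemma emeasure_bin2_cell: "emeasure lborel (bin2 a h -` {m}) = ennreal (h\<^sup>2)"
  unfolding bin2_vimage lborel_prod[symmetric] using h bin_cell_sets
  by (subst lborel.emeasure_pair_measure_Times)
    (auto simp: emeasure_bin_cell power2_eq_square ennreal_mult)

lemma bin2_measurable: "bin2 a h \<in> measurable borel (count_space UNIV)"
  using bin2_cell_sets by (simp add: measurable_count_space_eq2_countable)

lemma bin2_eq_imp_dist_le:
  assumes "bin2 a h z = bin2 a h z'"
  shows "dist z z' \<le> 2 * h"
proof -
  have "dist (fst z) (fst z') \<le> h" "dist (snd z) (snd z') \<le> h"
    using assms bin_eq_imp_dist_le by (auto simp: bin2_def)
  moreover have "dist z z' \<le> dist (fst z) (fst z') + dist (snd z) (snd z')"
    unfolding dist_prod_def by (rule sqrt_sum_squares_le_sum) auto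
  ultimately show ?thesis by simp
qed

lemma bin_image_interval:
  assumes "R \<ge> 0"
  shows "finite (bin a h ` {-R..R})" "card (bin a h ` {-R..R}) \<le> 2 * R / h + 2"
proof -
  let ?l = "bin a h (-R)" and ?u = "bin a h R"
  have sub: "bin a h ` {-R..R} \<subseteq> {?l..?u}"
    using h by (auto simp: bin_def intro!: floor_mono divide_right_mono)
  then show "finite (bin a h ` {-R..R})" by (rule finite_subset) simp
  have "?l \<le> ?u" using h assms by (auto simp: bin_def intro!: floor_mono divide_right_mono)
  have "card (bin a h ` {-R..R}) \<le> card {?l..?u}" using sub by (intro card_mono) auto
  also have "real (card {?l..?u}) = of_int ?u - of_int ?l + 1" using \<open>?l \<le> ?u\<close> by simp
  also have "\<dots> \<le> (R - a) / h - ((- R - a) / h - 1) + 1" unfolding bin_def by linarith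
  also have "\<dots> = 2 * R / h + 2" by (simp add: diff_divide_distrib)
  finally show "card (bin a h ` {-R..R}) \<le> 2 * R / h + 2" by simp
qed

end

text \<open>
  For \<open>h \<le> 1\<close> the interval \<open>{-R..R}\<close> meets at most \<open>2 * R / h + 2 \<le> (2 * R + 2) / h\<close> cells. This is the
  origin of \<open>2 * R + 2\<close> in the constant, here and in \<open>joint_histogram_risk\<close>.
\<close>

lemma (in prob_space) marginal_histogram_risk:
  fixes Z :: "nat \<Rightarrow> 'a \<Rightarrow> real"
  assumes n: "n \<ge> 1" and indep: "indep_vars (\<lambda>_. borel) Z {1..n}"
    and dist: "\<And>k. k \<in> {1..n} \<Longrightarrow> distributed M lborel (Z k) (\<lambda>z. ennreal (q z))"
    and q0: "\<And>z. 0 \<le> q z" and lip: "L-lipschitz_on UNIV q"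
    and supp: "\<And>k. k \<in> {1..n} \<Longrightarrow> AE \<omega> in M. Z k \<omega> \<in> {-R..R}"
    and R: "R \<ge> 0" and h: "h > 0"
  shows "(\<integral>\<^sup>+\<omega>. l1_dist (histogram (bin a h) h (map (\<lambda>k. Z k \<omega>) [1..<Suc n])) q \<partial>M)
    \<le> ennreal ((2 + (2 * R + 2) + 2 * L * (2 * R + 2)\<^sup>2) * (1 / sqrt (real n * h\<^sup>2) + h))"
proof (rule histogram_risk_rate[OF n indep dist q0 lip _ supp bin_measurable[OF h] h])
  let ?N = "real (card (bin a h ` {-R..R}))" and ?D = "2 * R + 2"
  have card: "?N \<le> 2 * R / h + 2" by (rule bin_image_interval(2)[OF h R])
  show "?N \<le> (?D / h)\<^sup>2" if "h \<le> 1"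
  proof -
    have "?N \<le> ?D / h" using card that h by (simp add: field_simps)
    also have "\<dots> \<le> (?D / h)\<^sup>2"
      using that h R by (intro self_le_power) (auto simp: field_simps)
    finally show ?thesis .
  qed
  show "?N * h \<le> ?D\<^sup>2" if "h \<le> 1"
  proof -
    have "?N * h \<le> (2 * R / h + 2) * h" using card h by (intro mult_right_mono) auto
    also have "\<dots> \<le> ?D" using that h by (simp add: field_simps)
    also have "\<dots> \<le> ?D\<^sup>2" using R by (intro self_le_power) auto
    finally show ?thesis .
  qed
  show "dist z z' \<le> 2 * h" if "bin a h z = bin a h z'" for z z'
    using bin_eq_imp_dist_le[OF h that] h by simp
qed (use h R in \<open>auto intro: bin_image_interval(1)[OF h R] emeasure_bin_cell[OF h]\<close>)

lemma (in prob_space) joint_histogram_risk: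
  fixes Z :: "nat \<Rightarrow> 'a \<Rightarrow> real \<times> real"
  assumes n: "n \<ge> 1" and indep: "indep_vars (\<lambda>_. borel) Z {1..n}"
    and dist: "\<And>k. k \<in> {1..n} \<Longrightarrow> distributed M lborel (Z k) (\<lambda>z. ennreal (q z))"
    and q0: "\<And>z. 0 \<le> q z" and lip: "L-lipschitz_on UNIV q"
    and supp: "\<And>k. k \<in> {1..n} \<Longrightarrow> AE \<omega> in M. Z k \<omega> \<in> {-R..R} \<times> {-R..R}"
    and R: "R \<ge> 0" and h: "h > 0"
  shows "(\<integral>\<^sup>+\<omega>. l1_dist (histogram (bin2 a h) (h\<^sup>2) (map (\<lambda>k. Z k \<omega>) [1..<Suc n])) q \<partial>M)
    \<le> ennreal ((2 + (2 * R + 2) + 2 * L * (2 * R + 2)\<^sup>2) * (1 / sqrt (real n * h\<^sup>2) + h))"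
proof -
  let ?B = "bin a h ` {-R..R}" and ?S = "{-R..R} \<times> {-R..R}" and ?D = "2 * R + 2"
  have sub: "bin2 a h ` ?S \<subseteq> ?B \<times> ?B" by (auto simp: bin2_def)
  have fin: "finite (?B \<times> ?B)" using bin_image_interval(1)[OF h R] by simp
  have card: "real (card (bin2 a h ` ?S)) \<le> (?D / h)\<^sup>2" if "h \<le> 1"
  proof -
    have "real (card (bin2 a h ` ?S)) \<le> real (card (?B \<times> ?B))"
      using card_mono[OF fin sub] by simp
    also have "\<dots> = (real (card ?B))\<^sup>2" by (simp add: card_cartesian_product power2_eq_square)
    also have "\<dots> \<le> (?D / h)\<^sup>2"
    proof (rule power_mono)
      have "real (card ?B) \<le> 2 * R / h + 2" by (rule bin_image_interval(2)[OF h R])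
      also have "\<dots> \<le> ?D / h" using that h by (simp add: field_simps)
      finally show "real (card ?B) \<le> ?D / h" .
    qed simp
    finally show ?thesis .
  qed
  show ?thesis
  proof (rule histogram_risk_rate[OF n indep dist q0 lip _ supp bin2_measurable[OF h] _ _ h])
    show "?S \<in> sets borel" by (intro borel_Times) auto
    show "finite (bin2 a h ` ?S)" using fin sub by (rule finite_subset[rotated])
    show "real (card (bin2 a h ` ?S)) * h\<^sup>2 \<le> ?D\<^sup>2" if "h \<le> 1"
    proof -
      have "real (card (bin2 a h ` ?S)) * h\<^sup>2 \<le> (?D / h)\<^sup>2 * h\<^sup>2"
        by (intro mult_right_mono card that) simp
      also have "\<dots> = ?D\<^sup>2" using h by (simp add: power_divide)
      finally show ?thesis .
    qed
  qed (use h R in \<open>auto intro: card emeasure_bin2_cell[OF h] bin2_eq_imp_dist_le[OF h]\<close>)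
qed

section \<open>The tree density estimate\<close>

definition marginal_histogram :: "real \<Rightarrow> real \<Rightarrow> (real ^ 'd) list \<Rightarrow> 'd \<Rightarrow> real \<Rightarrow> real" where
  "marginal_histogram a h xs i = histogram (bin a h) h (map (\<lambda>x. x $ i) xs)"

definition joint_histogram ::
    "real \<Rightarrow> real \<Rightarrow> (real ^ 'd) list \<Rightarrow> 'd \<Rightarrow> 'd \<Rightarrow> real \<times> real \<Rightarrow> real" where
  "joint_histogram a h xs i j = histogram (bin2 a h) (h\<^sup>2) (map (\<lambda>x. (x $ i, x $ j)) xs)"

lemma joint_histogram_swap: "joint_histogram a h xs i j (s, t) = joint_histogram a h xs j i (t, s)"
  unfolding joint_histogram_def histogram_def by (simp add: o_def bin2_def conj_commute)

text \<open>
  Integrating one coordinate over its cell, of length \<open>h\<close>, turns the weight \<open>1 / h\<^sup>2\<close> into \<open>1 / h\<close>, so the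
  joint and marginal histograms are consistent with each other, exactly and at every point.
\<close>

lemma joint_histogram_marginal:
  assumes h: "h > 0"
  shows "(\<integral>\<^sup>+s. ennreal (joint_histogram a h xs i j (s, t)) \<partial>lborel) = ennreal (marginal_histogram a h xs j t)"
proof -
  let ?n = "length xs"
  let ?g = "\<lambda>k. of_bool (bin a h (xs ! k $ j) = bin a h t) / (real ?n * h\<^sup>2)"
  have "joint_histogram a h xs i j (s, t)
      = (\<Sum>k<?n. ?g k * indicator (bin a h -` {bin a h (xs ! k $ i)}) s)" for s
    unfolding joint_histogram_def histogram_eq_sum
    by (auto intro!: sum.cong simp: bin2_def indicator_def)
  then have "(\<integral>\<^sup>+s. ennreal (joint_histogram a h xs i j (s, t)) \<partial>lborel) = ennreal (\<Sum>k<?n. ?g k * h)"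
    using h bin_cell_sets[OF h] emeasure_bin_cell[OF h]
    by (simp only:) (intro nn_integral_sum_cells, auto)
  also have "(\<Sum>k<?n. ?g k * h) = marginal_histogram a h xs j t"
    unfolding marginal_histogram_def histogram_eq_sum using h
    by (auto intro!: sum.cong simp: indicator_def power2_eq_square)
  finally show ?thesis .
qed

lemma dominated_joints_histogram:
  assumes h: "h > 0"
  shows "dominated_joints (marginal_histogram a h xs) (joint_histogram a h xs)"
  unfolding dominated_joints_def
proof (intro conjI allI impI)
  fix i j t
  show "marginal_histogram a h xs i \<in> borel_measurable borel"
    unfolding marginal_histogram_def by (intro histogram_measurable bin_cell_sets h)
  show "0 \<le> marginal_histogram a h xs i t"
    unfolding marginal_histogram_def by (intro histogram_nonneg h)
  show "joint_histogram a h xs i j \<in> borel_measurable borel"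
    unfolding joint_histogram_def by (intro histogram_measurable bin2_cell_sets h)
  show "0 \<le> joint_histogram a h xs i j z" for z
    unfolding joint_histogram_def using h by (intro histogram_nonneg) simp
  show "(\<integral>\<^sup>+s. ennreal (joint_histogram a h xs i j (s, t)) \<partial>lborel) \<le> ennreal (marginal_histogram a h xs j t)"
    by (simp add: joint_histogram_marginal[OF h])
  show "(\<integral>\<^sup>+s. ennreal (joint_histogram a h xs i j (t, s)) \<partial>lborel) \<le> ennreal (marginal_histogram a h xs i t)"
    unfolding joint_histogram_swap[of a h xs i j] by (simp add: joint_histogram_marginal[OF h])
qed

text \<open>
  The conditional histogram is a quotient of a joint and a marginal histogram. With \<open>x / 0 = 0\<close> this
  includes the cells without observations.
\<close>

lemma tree_estimate_eq_rooted_density: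
  assumes h: "h > 0" and cell: "\<And>s t. s \<in> cell P t \<longleftrightarrow> bin a h s = bin a h t"
  shows "tree_estimate h P xs T k x = rooted_density (marginal_histogram a h xs)
    (joint_histogram a h xs) (parent T k) k UNIV (\<lambda>i. x $ i)"
proof -
  have m: "emp1 xs i (cell P t) / h = marginal_histogram a h xs i t" for i t
    unfolding emp1_def cell marginal_histogram_def histogram_def by (simp add: o_def)
  have j: "emp2 xs i j (cell P s) (cell P t) / h\<^sup>2 = joint_histogram a h xs i j (s, t)" for i j s t
    unfolding emp2_def cell joint_histogram_def histogram_def by (simp add: o_def bin2_def)
  have "cond_histogram h P xs i j s t = joint_histogram a h xs i j (s, t) / marginal_histogram a h xs j t"
    for i j s t
    unfolding cond_histogram_def m[symmetric] j[symmetric] using h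
    by (simp add: power2_eq_square field_simps)
  then show ?thesis unfolding tree_estimate_def rooted_density_def m by simp
qed

lemma vec_nth_measurable [measurable]: "(\<lambda>x :: real ^ 'd::finite. x $ i) \<in> borel_measurable borel"
  by (intro borel_measurable_continuous_onI continuous_intros)

text \<open>
  The right-hand side depends neither on the tree nor on the root, and each of its terms is a
  measurable function of the sample. This makes it possible to insert a tree chosen from the data
  and to take expectations afterwards, even when the choice is not measurable.
\<close>

lemma (in continuous_marginals) tree_estimate_error_le:
  assumes T: "T \<in> spanning_trees" and h: "h > 0"
    and cell: "\<And>s t. s \<in> cell P t \<longleftrightarrow> bin a h s = bin a h t"
  shows "(\<integral>\<^sup>+x. ennreal \<bar>tree_estimate h P xs T k x - tree_density f1 f2 T x\<bar> \<partial>lborel)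
    \<le> (\<Sum>i\<in>UNIV. l1_dist (marginal_histogram a h xs i) (f1 i)) +
      (\<Sum>i\<in>UNIV. \<Sum>j\<in>UNIV - {i}. l1_dist (joint_histogram a h xs i j) (f2 i j) +
        l1_dist (marginal_histogram a h xs j) (f1 j))"
proof -
  let ?par = "parent T k"
  let ?p1 = "marginal_histogram a h xs" and ?p2 = "joint_histogram a h xs"
  let ?p = "rooted_density ?p1 ?p2 ?par k UNIV" and ?q = "rooted_density f1 f2 ?par k UNIV"
  let ?E = "\<lambda>i j. l1_dist (?p2 i j) (f2 i j) + l1_dist (?p1 j) (f1 j)"
  note dp = dominated_joints_histogram[OF h, of a xs] and dq = dominated_joints_density
  note gr = grown_parent_UNIV[OF T, of k]
  have neq: "?par i \<noteq> i" if "i \<noteq> k" for i using parent_neq[OF T that] .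
  have coords: "(\<lambda>x i. x $ i) \<in> measurable (borel :: (real ^ 'd::_) measure) (Pi\<^sub>M UNIV (\<lambda>_. lborel))"
    by (rule measurable_PiM_single') auto
  have "(\<lambda>x. ?p (\<lambda>i. x $ i)) \<in> borel_measurable borel" "(\<lambda>x. ?q (\<lambda>i. x $ i)) \<in> borel_measurable borel"
    using measurable_compose[OF coords rooted_density_measurable[OF dp gr neq]]
      measurable_compose[OF coords rooted_density_measurable[OF dq gr neq]] by auto
  then have meas: "(\<lambda>x. ennreal \<bar>?p (\<lambda>i. x $ i) - ?q (\<lambda>i. x $ i)\<bar>) \<in> borel_measurable borel"
    by (intro measurable_compose[OF _ measurable_ennreal] borel_measurable_abs borel_measurable_diff)
  have "(\<integral>\<^sup>+x. ennreal \<bar>tree_estimate h P xs T k x - tree_density f1 f2 T x\<bar> \<partial>lborel)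
      = (\<integral>\<^sup>+x. ennreal \<bar>?p (\<lambda>i. x $ i) - ?q (\<lambda>i. x $ i)\<bar> \<partial>lborel)"
    by (simp only: tree_estimate_eq_rooted_density[OF h cell] tree_density_eq_rooted_density[OF T, of _ k])
  also have "\<dots> = (\<integral>\<^sup>+x. ennreal \<bar>?p x - ?q x\<bar> \<partial>Pi\<^sub>M UNIV (\<lambda>_. lborel))"
  proof -
    have "($) (vec_lambda x) = x" for x :: "'d \<Rightarrow> real" by (rule ext) simp
    then show ?thesis unfolding nn_integral_lborel_vec[OF meas] by simp
  qed
  also have "\<dots> \<le> l1_dist (?p1 k) (f1 k) + (\<Sum>i\<in>UNIV - {k}. ?E i (?par i))"
    by (rule l1_dist_rooted_density[OF dp dq gr neq])
  also have "\<dots> \<le> (\<Sum>i\<in>UNIV. l1_dist (?p1 i) (f1 i)) + (\<Sum>i\<in>UNIV. \<Sum>j\<in>UNIV - {i}. ?E i j)"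
  proof (rule add_mono)
    show "l1_dist (?p1 k) (f1 k) \<le> (\<Sum>i\<in>UNIV. l1_dist (?p1 i) (f1 i))"
      by (rule member_le_sum) auto
    have "(\<Sum>i\<in>UNIV - {k}. ?E i (?par i)) \<le> (\<Sum>i\<in>UNIV - {k}. \<Sum>j\<in>UNIV - {i}. ?E i j)"
    proof (rule sum_mono)
      fix i assume "i \<in> UNIV - {k}"
      then have "?par i \<in> UNIV - {i}" using neq[of i] by simp
      then show "?E i (?par i) \<le> (\<Sum>j\<in>UNIV - {i}. ?E i j)"
        by (rule member_le_sum) auto
    qed
    also have "\<dots> \<le> (\<Sum>i\<in>UNIV. \<Sum>j\<in>UNIV - {i}. ?E i j)" by (rule sum_mono2) auto
    finally show "(\<Sum>i\<in>UNIV - {k}. ?E i (?par i)) \<le> (\<Sum>i\<in>UNIV. \<Sum>j\<in>UNIV - {i}. ?E i j)" .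
  qed
  finally show ?thesis .
qed

lemma distributed_cong_distr:
  assumes d: "distr M borel Y = distr M borel X"
    and [measurable]: "X \<in> borel_measurable M" "Y \<in> borel_measurable M" "g \<in> borel_measurable borel"
    and X: "distributed M lborel (\<lambda>\<omega>. g (X \<omega>)) q"
  shows "distributed M lborel (\<lambda>\<omega>. g (Y \<omega>)) q"
proof -
  have "distr M lborel (\<lambda>\<omega>. g (Y \<omega>)) = distr (distr M borel Y) lborel g"
    by (subst distr_distr) (auto simp: o_def)
  also have "\<dots> = distr M lborel (\<lambda>\<omega>. g (X \<omega>))"
    unfolding d by (subst distr_distr) (auto simp: o_def)
  finally show ?thesis using X unfolding distributed_def by simp
qed

theorem theorem2:
  fixes M :: "'a measure"
    and X :: "'a \<Rightarrow> real ^ 'd::{finite,linorder}"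
    and Xs :: "nat \<Rightarrow> 'a \<Rightarrow> real ^ 'd::_"
    and f :: "real ^ 'd::_ \<Rightarrow> real"
    and f1 :: "'d \<Rightarrow> real \<Rightarrow> real"
    and f2 :: "'d \<Rightarrow> 'd \<Rightarrow> real \<times> real \<Rightarrow> real"
    and \<gamma> :: real
  assumes "prob_space M"
    and "\<And>x. f x \<ge> 0"
    and "distributed M lborel X (\<lambda>x. ennreal (f x))"
    and "prob_space.indep_vars M (\<lambda>_. borel) Xs {1..}"
    and "\<And>k. k \<ge> 1 \<Longrightarrow> distr M borel (Xs k) = distr M borel X"
    and "\<And>i t. f1 i t \<ge> 0"
    and "\<And>i. distributed M lborel (\<lambda>\<omega>. X \<omega> $ i) (\<lambda>t. ennreal (f1 i t))"
    and "\<And>i j z. i \<noteq> j \<Longrightarrow> f2 i j z \<ge> 0"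
    and "\<And>i j. i \<noteq> j \<Longrightarrow>
           distributed M lborel (\<lambda>\<omega>. (X \<omega> $ i, X \<omega> $ j)) (\<lambda>z. ennreal (f2 i j z))"
    and "\<exists>S. bounded S \<and> (AE \<omega> in M. X \<omega> \<in> S)"
    and "\<And>i. \<exists>L. L-lipschitz_on UNIV (f1 i)"
    and "\<And>i j. i \<noteq> j \<Longrightarrow> \<exists>L. L-lipschitz_on UNIV (f2 i j)"
    and "\<gamma> > 0"
  shows "\<exists>C. \<forall>(h :: nat \<Rightarrow> real) (h' :: nat \<Rightarrow> real) P P' T root.
    (\<forall>n. h n > 0) \<longrightarrow> (\<forall>n. h' n > 0) \<longrightarrow>
    filterlim (\<lambda>n. real n * (h' n)\<^sup>2) at_top sequentially \<longrightarrow>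
    (\<forall>n. uniform_partition (h n) (P n)) \<longrightarrow>
    (\<forall>n. uniform_partition (h' n) (P' n)) \<longrightarrow>
    (\<forall>n\<ge>1. \<forall>xs. length xs = n \<longrightarrow> T n xs \<in> best_trees (P' n) xs) \<longrightarrow>
    (\<forall>n\<ge>1.
      (\<integral>\<^sup>+\<omega>. (let xs = map (\<lambda>k. Xs k \<omega>) [1..<Suc n]; Tn = T n xs in
         \<integral>\<^sup>+x. ennreal \<bar>tree_estimate (h n) (P n) xs Tn (root Tn) x - tree_density f1 f2 Tn x\<bar>
           \<partial>lborel) \<partial>M)
      \<le> ennreal (C * (1 / sqrt (real n * (h n)\<^sup>2) + h n + h' n powr \<gamma> + 1 / (real n * (h' n)\<^sup>2))))"
proof -
  interpret prob_space M by fact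
  define L1 where "L1 i = (SOME L. L-lipschitz_on UNIV (f1 i))" for i
  have L1: "(L1 i)-lipschitz_on UNIV (f1 i)" for i
    unfolding L1_def by (rule someI_ex[OF assms(11)])
  define L2 where "L2 i j = (SOME L. L-lipschitz_on UNIV (f2 i j))" for i j
  have L2: "(L2 i j)-lipschitz_on UNIV (f2 i j)" if "i \<noteq> j" for i j
    unfolding L2_def by (rule someI_ex[OF assms(12)[OF that]])
  interpret continuous_marginals M X f1 f2
    by unfold_locales
      (fact assms(6) assms(7) assms(8) assms(9) lipschitz_on_continuous_on[OF L1]
        lipschitz_on_continuous_on[OF L2])+
  have f1_meas: "f1 i \<in> borel_measurable borel" for i
    by (rule borel_measurable_continuous_onI[OF f1_cont])
  have f2_meas: "f2 i j \<in> borel_measurable borel" if "i \<noteq> j" for i j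
    by (rule borel_measurable_continuous_onI[OF f2_cont[OF that]])
  have X_rv[measurable]: "X \<in> borel_measurable M"
    using distributed_measurable[OF assms(3)] by simp
  have Xs_rv[measurable]: "Xs k \<in> borel_measurable M" if "k \<ge> 1" for k
    using assms(4) that unfolding indep_vars_def by auto
  obtain S where "bounded S" and S: "AE \<omega> in M. X \<omega> \<in> S" using assms(10) by blast
  then obtain R where R: "R > 0" "\<And>x. x \<in> S \<Longrightarrow> norm x \<le> R" by (auto simp: bounded_pos)
  have X_bd: "AE \<omega> in M. norm (X \<omega>) \<le> R" using S by eventually_elim (rule R(2))
  have Xs_bd: "AE \<omega> in M. norm (Xs k \<omega>) \<le> R" if k: "k \<ge> 1" for k
  proof -
    have "AE x in distr M borel X. norm x \<le> R" using X_bd by (subst AE_distr_iff) auto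
    then have "AE x in distr M borel (Xs k). norm x \<le> R" by (simp only: assms(5)[OF k])
    then show ?thesis using Xs_rv[OF k] by (subst (asm) AE_distr_iff) auto
  qed
  have coord: "x $ i \<in> {-R..R}" if "norm x \<le> R" for x :: "real ^ 'd::_" and i
    using component_le_norm_cart[of x i] that by (auto simp: abs_le_iff)
  let ?D = "2 * R + 2"
  define K1 where "K1 i = 2 + ?D + 2 * L1 i * ?D\<^sup>2" for i
  define K2 where "K2 i j = 2 + ?D + 2 * L2 i j * ?D\<^sup>2" for i j
  have K1_0: "0 \<le> K1 i" for i
    using lipschitz_on_nonneg[OF L1[of i]] R(1) by (auto simp: K1_def)
  have K2_0: "0 \<le> K2 i j" if "i \<noteq> j" for i j
    using lipschitz_on_nonneg[OF L2[OF that]] R(1) by (auto simp: K2_def)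
  define C where "C = (\<Sum>i\<in>UNIV. K1 i) + (\<Sum>i\<in>UNIV. \<Sum>j\<in>UNIV - {i}. K2 i j + K1 j)"
  have C0: "0 \<le> C" unfolding C_def
    by (intro add_nonneg_nonneg sum_nonneg K1_0) (auto intro!: add_nonneg_nonneg K1_0 K2_0)
  show ?thesis
  proof (rule exI[of _ C], intro allI impI)
    fix h h' :: "nat \<Rightarrow> real" and P P' :: "nat \<Rightarrow> real set set"
      and T :: "nat \<Rightarrow> (real ^ 'd::_) list \<Rightarrow> ('d \<times> 'd) set" and root and n :: nat
    assume hpos: "\<forall>n. h n > 0" and h'pos: "\<forall>n. h' n > 0"
      and part: "\<forall>n. uniform_partition (h n) (P n)"
      and best: "\<forall>n\<ge>1. \<forall>xs. length xs = n \<longrightarrow> T n xs \<in> best_trees (P' n) xs"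
      and n: "n \<ge> 1"
    let ?h = "h n" and ?xs = "\<lambda>\<omega>. map (\<lambda>k. Xs k \<omega>) [1..<Suc n]"
    let ?r = "1 / sqrt (real n * ?h\<^sup>2) + ?h"
    have h: "?h > 0" using hpos by simp
    obtain a where cell: "\<And>s t. s \<in> cell (P n) t \<longleftrightarrow> bin a ?h s = bin a ?h t"
      using uniform_partition_cell part by blast
    have r0: "0 \<le> ?r" using h by simp
    let ?A = "\<lambda>\<omega> i. l1_dist (marginal_histogram a ?h (?xs \<omega>) i) (f1 i)"
    let ?B = "\<lambda>\<omega> i j. l1_dist (joint_histogram a ?h (?xs \<omega>) i j) (f2 i j)"
    have indep: "indep_vars (\<lambda>_. borel) Xs {1..n}"
      by (rule indep_vars_subset[OF assms(4)]) auto
    have A_eq: "?A \<omega> i = l1_dist (histogram (bin a ?h) ?h (map (\<lambda>k. Xs k \<omega> $ i) [1..<Suc n])) (f1 i)"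
      for \<omega> i by (simp add: marginal_histogram_def o_def del: upt_Suc)
    have B_eq: "?B \<omega> i j = l1_dist (histogram (bin2 a ?h) (?h\<^sup>2)
      (map (\<lambda>k. (Xs k \<omega> $ i, Xs k \<omega> $ j)) [1..<Suc n])) (f2 i j)"
      for \<omega> i j by (simp add: joint_histogram_def o_def del: upt_Suc)
    have A_meas: "(\<lambda>\<omega>. ?A \<omega> i) \<in> borel_measurable M" for i
      unfolding A_eq
      by (intro histogram_l1_measurable bin_measurable[OF h] f1_meas
          measurable_compose[OF Xs_rv vec_nth_measurable]) simp
    have B_meas: "(\<lambda>\<omega>. ?B \<omega> i j) \<in> borel_measurable M" if "i \<noteq> j" for i j
      unfolding B_eq
      by (intro histogram_l1_measurable bin2_measurable[OF h] f2_meas that borel_measurable_Pair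
          measurable_compose[OF Xs_rv vec_nth_measurable]) simp_all
    have A_risk: "(\<integral>\<^sup>+\<omega>. ?A \<omega> i \<partial>M) \<le> ennreal (K1 i * ?r)" for i
      unfolding A_eq K1_def
    proof (rule marginal_histogram_risk[OF n _ _ assms(6) L1 _ _ h])
      show "indep_vars (\<lambda>_. borel) (\<lambda>k \<omega>. Xs k \<omega> $ i) {1..n}"
        by (rule indep_vars_compose2[OF indep]) measurable
      fix k assume k: "k \<in> {1..n}"
      show "distributed M lborel (\<lambda>\<omega>. Xs k \<omega> $ i) (\<lambda>t. ennreal (f1 i t))"
        by (rule distributed_cong_distr[where g = "\<lambda>x. x $ i", OF assms(5) X_rv Xs_rv _ assms(7)])
          (use k in auto)
      show "AE \<omega> in M. Xs k \<omega> $ i \<in> {-R..R}"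
        by (rule eventually_mono[OF Xs_bd coord]) (use k in auto)
    qed (use R in simp)
    have B_risk: "(\<integral>\<^sup>+\<omega>. ?B \<omega> i j \<partial>M) \<le> ennreal (K2 i j * ?r)" if ij: "i \<noteq> j" for i j
      unfolding B_eq K2_def
    proof (rule joint_histogram_risk[OF n _ _ assms(8)[OF ij] L2[OF ij] _ _ h])
      show "indep_vars (\<lambda>_. borel) (\<lambda>k \<omega>. (Xs k \<omega> $ i, Xs k \<omega> $ j)) {1..n}"
        by (rule indep_vars_compose2[OF indep]) measurable
      fix k assume k: "k \<in> {1..n}"
      show "distributed M lborel (\<lambda>\<omega>. (Xs k \<omega> $ i, Xs k \<omega> $ j)) (\<lambda>z. ennreal (f2 i j z))"
        by (rule distributed_cong_distr[where g = "\<lambda>x. (x $ i, x $ j)",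
              OF assms(5) X_rv Xs_rv _ assms(9)[OF ij]])
          (use k in auto)
      show "AE \<omega> in M. (Xs k \<omega> $ i, Xs k \<omega> $ j) \<in> {-R..R} \<times> {-R..R}"
        by (rule eventually_mono[OF Xs_bd]) (use k coord in auto)
    qed (use R in simp)
    have pw: "(let xs = ?xs \<omega>; Tn = T n xs in
         \<integral>\<^sup>+x. ennreal \<bar>tree_estimate ?h (P n) xs Tn (root Tn) x - tree_density f1 f2 Tn x\<bar> \<partial>lborel)
      \<le> (\<Sum>i\<in>UNIV. ?A \<omega> i) + (\<Sum>i\<in>UNIV. \<Sum>j\<in>UNIV - {i}. ?B \<omega> i j + ?A \<omega> j)" for \<omega>
    proof -
      have "length (?xs \<omega>) = n" by simp
      then have "T n (?xs \<omega>) \<in> best_trees (P' n) (?xs \<omega>)" using best n by blast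
      then have "T n (?xs \<omega>) \<in> spanning_trees" by (simp add: best_trees_def is_arg_max_def)
      then show ?thesis unfolding Let_def by (rule tree_estimate_error_le[OF _ h cell])
    qed
    have "(\<integral>\<^sup>+\<omega>. (let xs = ?xs \<omega>; Tn = T n xs in
         \<integral>\<^sup>+x. ennreal \<bar>tree_estimate ?h (P n) xs Tn (root Tn) x - tree_density f1 f2 Tn x\<bar> \<partial>lborel) \<partial>M)
      \<le> (\<integral>\<^sup>+\<omega>. (\<Sum>i\<in>UNIV. ?A \<omega> i) + (\<Sum>i\<in>UNIV. \<Sum>j\<in>UNIV - {i}. ?B \<omega> i j + ?A \<omega> j) \<partial>M)"
      by (intro nn_integral_mono pw)
    also have "\<dots> = (\<Sum>i\<in>UNIV. \<integral>\<^sup>+\<omega>. ?A \<omega> i \<partial>M)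
        + (\<Sum>i\<in>UNIV. \<Sum>j\<in>UNIV - {i}. (\<integral>\<^sup>+\<omega>. ?B \<omega> i j \<partial>M) + (\<integral>\<^sup>+\<omega>. ?A \<omega> j \<partial>M))"
    proof -
      have AB: "(\<lambda>\<omega>. ?B \<omega> i j + ?A \<omega> j) \<in> borel_measurable M" if "j \<in> UNIV - {i}" for i j
        using that by (intro borel_measurable_add A_meas B_meas) auto
      have row: "(\<lambda>\<omega>. \<Sum>j\<in>UNIV - {i}. ?B \<omega> i j + ?A \<omega> j) \<in> borel_measurable M" for i
        by (intro borel_measurable_sum AB)
      have "(\<integral>\<^sup>+\<omega>. (\<Sum>i\<in>UNIV. ?A \<omega> i) + (\<Sum>i\<in>UNIV. \<Sum>j\<in>UNIV - {i}. ?B \<omega> i j + ?A \<omega> j) \<partial>M)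
        = (\<integral>\<^sup>+\<omega>. (\<Sum>i\<in>UNIV. ?A \<omega> i) \<partial>M)
          + (\<integral>\<^sup>+\<omega>. (\<Sum>i\<in>UNIV. \<Sum>j\<in>UNIV - {i}. ?B \<omega> i j + ?A \<omega> j) \<partial>M)"
        by (intro nn_integral_add borel_measurable_sum A_meas row)
      also have "(\<integral>\<^sup>+\<omega>. (\<Sum>i\<in>UNIV. ?A \<omega> i) \<partial>M) = (\<Sum>i\<in>UNIV. \<integral>\<^sup>+\<omega>. ?A \<omega> i \<partial>M)"
        by (intro nn_integral_sum A_meas)
      also have "(\<integral>\<^sup>+\<omega>. (\<Sum>i\<in>UNIV. \<Sum>j\<in>UNIV - {i}. ?B \<omega> i j + ?A \<omega> j) \<partial>M)
        = (\<Sum>i\<in>UNIV. \<integral>\<^sup>+\<omega>. (\<Sum>j\<in>UNIV - {i}. ?B \<omega> i j + ?A \<omega> j) \<partial>M)"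
        by (intro nn_integral_sum row)
      also have "\<dots> = (\<Sum>i\<in>UNIV. \<Sum>j\<in>UNIV - {i}. \<integral>\<^sup>+\<omega>. ?B \<omega> i j + ?A \<omega> j \<partial>M)"
        by (intro sum.cong refl nn_integral_sum AB)
      also have "\<dots> = (\<Sum>i\<in>UNIV. \<Sum>j\<in>UNIV - {i}. (\<integral>\<^sup>+\<omega>. ?B \<omega> i j \<partial>M) + (\<integral>\<^sup>+\<omega>. ?A \<omega> j \<partial>M))"
        by (intro sum.cong refl nn_integral_add A_meas B_meas) auto
      finally show ?thesis .
    qed
    also have "\<dots> \<le> (\<Sum>i\<in>UNIV. ennreal (K1 i * ?r))
        + (\<Sum>i\<in>UNIV. \<Sum>j\<in>UNIV - {i}. ennreal (K2 i j * ?r) + ennreal (K1 j * ?r))"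
      by (intro add_mono sum_mono A_risk B_risk) auto
    also have "\<dots> = ennreal (C * ?r)"
    proof -
      have "(\<Sum>j\<in>UNIV - {i}. ennreal (K2 i j * ?r) + ennreal (K1 j * ?r))
          = ennreal (\<Sum>j\<in>UNIV - {i}. (K2 i j + K1 j) * ?r)" for i
      proof -
        have "(\<Sum>j\<in>UNIV - {i}. ennreal (K2 i j * ?r) + ennreal (K1 j * ?r))
            = (\<Sum>j\<in>UNIV - {i}. ennreal ((K2 i j + K1 j) * ?r))"
          unfolding distrib_right[of "K2 _ _" "K1 _" ?r]
          by (intro sum.cong refl ennreal_plus[symmetric] mult_nonneg_nonneg K1_0 K2_0 r0) auto
        also have "\<dots> = ennreal (\<Sum>j\<in>UNIV - {i}. (K2 i j + K1 j) * ?r)"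
          by (intro sum_ennreal mult_nonneg_nonneg add_nonneg_nonneg K1_0 K2_0 r0) auto
        finally show ?thesis .
      qed
      then have "(\<Sum>i\<in>UNIV. ennreal (K1 i * ?r))
          + (\<Sum>i\<in>UNIV. \<Sum>j\<in>UNIV - {i}. ennreal (K2 i j * ?r) + ennreal (K1 j * ?r))
        = ennreal (\<Sum>i\<in>UNIV. K1 i * ?r) + ennreal (\<Sum>i\<in>UNIV. \<Sum>j\<in>UNIV - {i}. (K2 i j + K1 j) * ?r)"
        by (simp only:) (intro arg_cong2[where f = "(+)"] sum_ennreal sum_nonneg mult_nonneg_nonneg
            add_nonneg_nonneg K1_0 K2_0 r0, auto)
      also have "\<dots> = ennreal ((\<Sum>i\<in>UNIV. K1 i * ?r) + (\<Sum>i\<in>UNIV. \<Sum>j\<in>UNIV - {i}. (K2 i j + K1 j) * ?r))"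
        by (intro ennreal_plus[symmetric] sum_nonneg mult_nonneg_nonneg add_nonneg_nonneg K1_0 K2_0 r0) auto
      also have "(\<Sum>i\<in>UNIV. K1 i * ?r) + (\<Sum>i\<in>UNIV. \<Sum>j\<in>UNIV - {i}. (K2 i j + K1 j) * ?r) = C * ?r"
        unfolding C_def distrib_right[of _ _ ?r] sum_distrib_right ..
      finally show ?thesis .
    qed
    also have "\<dots> \<le> ennreal (C * (?r + h' n powr \<gamma> + 1 / (real n * (h' n)\<^sup>2)))"
    proof (intro ennreal_leI mult_left_mono C0)
      have "0 \<le> h' n powr \<gamma>" "0 \<le> 1 / (real n * (h' n)\<^sup>2)" by auto
      then show "?r \<le> ?r + h' n powr \<gamma> + 1 / (real n * (h' n)\<^sup>2)" by linarith
    qed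
    finally show "(\<integral>\<^sup>+\<omega>. (let xs = ?xs \<omega>; Tn = T n xs in
         \<integral>\<^sup>+x. ennreal \<bar>tree_estimate ?h (P n) xs Tn (root Tn) x - tree_density f1 f2 Tn x\<bar> \<partial>lborel) \<partial>M)
      \<le> ennreal (C * (1 / sqrt (real n * ?h\<^sup>2) + ?h + h' n powr \<gamma> + 1 / (real n * (h' n)\<^sup>2)))" .
  qed
qed

end
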